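(* Let $T\colon X\to X$ be an open continuous distance-expanding map on a compact metric space $(X,d)$, and let $A\colon X\to\mathbb{R}$ be $\alpha$-Hölder continuous with $\alpha\in(0,1]$. Then the following statements are true: (i) (Uniqueness of tropical eigenvalue.) The number $Q(T,A)$ is the maximal tropical eigenvalue of $\mathcal{L}_A^{\circledast}$. If $\mathcal{L}_A$ admits a tropical eigenvalue, then it is equal to $Q(T,A)$. Moreover, if $T$ is transitive, then $Q(T,A)$ is the unique tropical eigenvalue of $\mathcal{L}_A^{\circledast}$. (ii) (Existence of tropical eigenfunction.) For each $u\in C^{0,\alpha}(X,d)$, define $v_u(x):=\limsup_{n\to+\infty}\mathcal{L}_{\overline{A}}^n(u)(x)$ for each $x\in X$, where $\overline{A}=A-Q(T,A)$. Then $v_u\in C(X,\mathbb{R}\cup\{-\infty\})$ and $\mathcal{L}_A(v_u)=v_u\otimes Q(T,A)$. Let $v_{\mathbf 0}$ denote $v_u$ for $u$ the constant zero function on $X$. If $v_{\mathbf 0}(x)=-\infty$ for some $x\in X$, then $\mathcal{L}_A$ has no tropical eigenfunction. If $v_{\mathbf 0}\in C(X,\mathbb{R})$, then $v_u\in C^{0,\alpha}(X,d)$ is a tropical eigenfunction of $\mathcal{L}_A$ for all $u\in C^{0,\alpha}(X,d)$. Moreover, if $T$ is transitive, then $v_{\mathbf 0}\in C(X,\mathbb{R})$. (iii) (Generic uniqueness of tropical eigenfunction.) For a generic potential $A$ in $C^{0,\alpha}(X,d)$, if there exists a tropical eigenfunction of $\mathcal{L}_A$, then it is unique up to a tropical multiplicative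 constant. (iv) (Existence of tropical eigen-density.) There exists a tropical eigen-density of $\mathcal{L}_A^{\circledast}$ associated with eigenvalue $Q(T,A)$ different from the constant density functions $-\infty$ and $+\infty$. (v) (Generic uniqueness of tropical eigen-density.) For a generic potential $A$ in $C^{0,\alpha}(X,d)$, $\mathcal{L}_A^{\circledast}$ has a unique tropical eigen-density associated with eigenvalue $Q(T,A)$ up to a tropical multiplicative constant.
   Context: $T$ is distance-expanding if there exist $\lambda>1$, $\eta>0$ such that $d(x,y)\le2\eta$ implies $d(Tx,Ty)\ge\lambda d(x,y)$. Transitive means topologically transitive. $C^{0,\alpha}(X,d)$ is the space of real-valued $\alpha$-Hölder continuous functions on $X$ with the Hölder norm. "For a generic potential" means for all potentials in some set containing a countable intersection of open dense subsets. $\overline{\mathbb{R}}_{\max}=\mathbb{R}\cup\{+\infty,-\infty\}$ with its usual order topology (basis $(a,b)$, $[-\infty,a)$, $(b,+\infty]$, $a,b\in\mathbb{R}$), $x\oplus y=\max\{x,y\}$ and $x\otimes y=x+y$, with conventions $(-\infty)\otimes(+\infty)=-\infty$ and $\sup\emptyset=-\infty$; operations on functions are pointwise. $C(X,\mathbb{R}\cup\{-\infty\})$ is the set of continuous functions into the subspace $\mathbb{R}\cup\{-\infty\}$. "Up to a tropical multiplicative constant" means up to $\otimes$ with (i.e. addition of) a real constant. $Q(T,A)=\sup\{\int A\,\mathrm{d}\mu:\mu\text{ a }T\text{-invariant Borel probability measure}\}$. For $B\in C(X,\mathbb{R})$, the Bousch operator is $\mathcal{L}_B(u)(x)=\sup_{y\in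 T^{-1}(x)}\{u(y)+B(y)\}$ for $u\colon X\to\overline{\mathbb{R}}_{\max}$. The space of densities is $D_{\max}(X)=\{b\colon X\to\mathbb{R}\cup\{-\infty\}: b\text{ upper semi-continuous}\}\cup\{+\infty\}$ (with $+\infty$ the constant function). The tropical adjoint operator $\mathcal{L}_A^{\circledast}\colon D_{\max}(X)\to D_{\max}(X)$ is $\mathcal{L}_A^{\circledast}(b)(x)=b(T(x))\otimes A(x)$. $\kappa\in\overline{\mathbb{R}}_{\max}$ is a tropical eigenvalue of $\mathcal{L}_A$ if there is $u\in C(X,\mathbb{R})$ (a tropical eigenfunction) with $\mathcal{L}_A(u)=u\otimes\kappa$. $\kappa\in\overline{\mathbb{R}}_{\max}$ is a tropical eigenvalue of $\mathcal{L}_A^{\circledast}$ if there is $b\in D_{\max}(X)\setminus\{+\infty,-\infty\}$ (a tropical eigen-density associated with $\kappa$) with $\mathcal{L}_A^{\circledast}(b)=b\otimes\kappa$; here $\pm\infty$ denote the constant functions. *)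

theory Defs
  imports "HOL-Probability.Probability"
begin

definition distance_expanding :: "('a::metric_space \<Rightarrow> 'a) \<Rightarrow> bool" where
  "distance_expanding T \<longleftrightarrow>
     (\<exists>l>1. \<exists>\<eta>>0. \<forall>x y. dist x y \<le> 2 * \<eta> \<longrightarrow> dist (T x) (T y) \<ge> l * dist x y)"

definition open_map_on_space :: "('a::topological_space \<Rightarrow> 'a) \<Rightarrow> bool" where
  "open_map_on_space T \<longleftrightarrow> (\<forall>U. open U \<longrightarrow> open (T ` U))"

definition topologically_transitive :: "('a::topological_space \<Rightarrow> 'a) \<Rightarrow> bool" where
  "topologically_transitive T \<longleftrightarrow>
     (\<forall>U V. open U \<and> U \<noteq> {} \<and> open V \<and> V \<noteq> {} \<longrightarrow> (\<exists>n. (T ^^ n) ` U \<inter> V \<noteq> {}))"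

definition invariant_probs :: "('a::topological_space \<Rightarrow> 'a) \<Rightarrow> 'a measure set" where
  "invariant_probs T = {M. sets M = sets borel \<and> prob_space M \<and> distr M borel T = M}"

definition Q :: "('a::topological_space \<Rightarrow> 'a) \<Rightarrow> ('a \<Rightarrow> real) \<Rightarrow> real" where
  "Q T A = (SUP M\<in>invariant_probs T. (\<integral>x. A x \<partial>M))"

definition holder_space :: "real \<Rightarrow> ('a::metric_space \<Rightarrow> real) set" where
  "holder_space \<alpha> = {f. \<exists>C. \<forall>x y. \<bar>f x - f y\<bar> \<le> C * dist x y powr \<alpha>}"

text \<open>Pairs with \<open>x = y\<close> contribute \<open>0 / 0 = 0\<close> to the seminorm.  Outside the Hoelder space the
  suprema may be taken over unbounded sets; the value 0 there keeps the distance below nonnegative on all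
  functions, as the locale \<open>Metric_space\<close> requires.\<close>

definition holder_norm :: "real \<Rightarrow> ('a::metric_space \<Rightarrow> real) \<Rightarrow> real" where
  "holder_norm \<alpha> f =
     (if f \<in> holder_space \<alpha>
      then (SUP x. \<bar>f x\<bar>) + (SUP (x, y). \<bar>f x - f y\<bar> / dist x y powr \<alpha>)
      else 0)"

definition holder_dist :: "real \<Rightarrow> ('a::metric_space \<Rightarrow> real) \<Rightarrow> ('a \<Rightarrow> real) \<Rightarrow> real" where
  "holder_dist \<alpha> f g = holder_norm \<alpha> (\<lambda>x. f x - g x)"

definition holder_topology :: "real \<Rightarrow> ('a::metric_space \<Rightarrow> real) topology" where
  "holder_topology \<alpha> = Metric_space.mtopology (holder_space \<alpha>) (holder_dist \<alpha>)"

lemma holder_spaceD: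
  fixes f :: "'a::metric_space \<Rightarrow> real"
  assumes "compact (UNIV :: 'a set)" and \<alpha>: "0 < \<alpha>" and f: "f \<in> holder_space \<alpha>"
  shows "bdd_above (range (\<lambda>x. \<bar>f x\<bar>))"
    and "bdd_above (range (\<lambda>(x, y). \<bar>f x - f y\<bar> / dist x y powr \<alpha>))"
proof -
  obtain C0 where C0: "\<And>x y. \<bar>f x - f y\<bar> \<le> C0 * dist x y powr \<alpha>"
    using f unfolding holder_space_def by blast
  define C where "C = max C0 0"
  have C: "\<bar>f x - f y\<bar> \<le> C * dist x y powr \<alpha>" for x y
    by (rule order_trans[OF C0]) (auto simp: C_def intro!: mult_right_mono)
  have "0 \<le> C" by (simp add: C_def)
  have "bounded (UNIV :: 'a set)" using assms(1) by (rule compact_imp_bounded)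
  then obtain z :: 'a and e where e: "\<And>y. dist z y \<le> e" unfolding bounded_def by auto
  have "\<bar>f x\<bar> \<le> \<bar>f z\<bar> + C * e powr \<alpha>" for x
  proof -
    have "\<bar>f z - f x\<bar> \<le> C * dist z x powr \<alpha>" by (rule C)
    also have "\<dots> \<le> C * e powr \<alpha>"
      using e[of x] \<alpha> \<open>0 \<le> C\<close> by (intro mult_left_mono powr_mono2) auto
    finally show ?thesis by linarith
  qed
  then show "bdd_above (range (\<lambda>x. \<bar>f x\<bar>))" by (auto simp: bdd_above_def)
  have "\<bar>f x - f y\<bar> / dist x y powr \<alpha> \<le> C" for x y
    using C[of x y] \<open>0 \<le> C\<close> by (cases "x = y") (auto simp: divide_le_eq)
  then show "bdd_above (range (\<lambda>(x, y). \<bar>f x - f y\<bar> / dist x y powr \<alpha>))"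
    by (auto simp: bdd_above_def)
qed

lemma holder_space_diff:
  assumes "f \<in> holder_space \<alpha>" "g \<in> holder_space \<alpha>"
  shows "(\<lambda>x. f x - g x) \<in> holder_space \<alpha>"
proof -
  obtain C D where "\<And>x y. \<bar>f x - f y\<bar> \<le> C * dist x y powr \<alpha>" "\<And>x y. \<bar>g x - g y\<bar> \<le> D * dist x y powr \<alpha>"
    using assms unfolding holder_space_def by blast
  then have "\<bar>(f x - g x) - (f y - g y)\<bar> \<le> (C + D) * dist x y powr \<alpha>" for x y
    unfolding distrib_right by (smt (verit))
  then show ?thesis unfolding holder_space_def by blast
qed

lemma holder_norm_ge:
  fixes f :: "'a::metric_space \<Rightarrow> real"
  assumes "compact (UNIV :: 'a set)" "0 < \<alpha>" "f \<in> holder_space \<alpha>"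
  shows "\<bar>f x\<bar> \<le> holder_norm \<alpha> f"
proof -
  have "\<bar>f x\<bar> \<le> (SUP x. \<bar>f x\<bar>)"
    by (rule cSUP_upper) (auto intro: holder_spaceD(1)[OF assms])
  moreover have "(case (x, x) of (x, y) \<Rightarrow> \<bar>f x - f y\<bar> / dist x y powr \<alpha>)
      \<le> (SUP (x, y). \<bar>f x - f y\<bar> / dist x y powr \<alpha>)"
    by (rule cSUP_upper) (auto intro: holder_spaceD(2)[OF assms])
  ultimately show ?thesis using assms(3) by (simp add: holder_norm_def)
qed

lemma Metric_space_holder:
  assumes "compact (UNIV :: 'a::metric_space set)" "0 < \<alpha>"
  shows "Metric_space (holder_space \<alpha> :: ('a \<Rightarrow> real) set) (holder_dist \<alpha>)"
proof
  note ge = holder_norm_ge[OF assms]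
  show "0 \<le> holder_dist \<alpha> f g" for f g :: "'a \<Rightarrow> real"
    unfolding holder_dist_def
    using ge[of "\<lambda>x. f x - g x" undefined]
    by (cases "(\<lambda>x. f x - g x) \<in> holder_space \<alpha>") (auto simp: holder_norm_def)
  show "holder_dist \<alpha> f g = holder_dist \<alpha> g f" for f g :: "'a \<Rightarrow> real"
  proof -
    have "\<bar>(f x - g x) - (f y - g y)\<bar> = \<bar>(g x - f x) - (g y - f y)\<bar>" for x y by linarith
    moreover have "\<bar>f x - g x\<bar> = \<bar>g x - f x\<bar>" for x by linarith
    ultimately show ?thesis
      by (simp only: holder_dist_def holder_norm_def holder_space_def mem_Collect_eq)
  qed
  fix f g :: "'a \<Rightarrow> real" assume fg: "f \<in> holder_space \<alpha>" "g \<in> holder_space \<alpha>"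
  show "holder_dist \<alpha> f g = 0 \<longleftrightarrow> f = g"
  proof
    assume "holder_dist \<alpha> f g = 0"
    then have "\<bar>f x - g x\<bar> \<le> 0" for x
      using ge[OF holder_space_diff[OF fg], of x] by (simp add: holder_dist_def)
    then show "f = g" by (auto intro!: ext)
  next
    assume "f = g"
    then show "holder_dist \<alpha> f g = 0"
      by (simp add: holder_dist_def holder_norm_def case_prod_unfold)
  qed
  fix h :: "'a \<Rightarrow> real" assume h: "h \<in> holder_space \<alpha>"
  let ?p = "\<lambda>x. f x - g x" and ?q = "\<lambda>x. g x - h x" and ?r = "\<lambda>x. f x - h x"
  let ?S = "\<lambda>k (x, y). \<bar>k x - k y\<bar> / dist x y powr \<alpha>"
  have m: "?p \<in> holder_space \<alpha>" "?q \<in> holder_space \<alpha>" "?r \<in> holder_space \<alpha>"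
    using fg h by (auto intro: holder_space_diff)
  note bp = holder_spaceD[OF assms m(1)] and bq = holder_spaceD[OF assms m(2)]
  have 1: "(SUP x. \<bar>?r x\<bar>) \<le> (SUP x. \<bar>?p x\<bar>) + (SUP x. \<bar>?q x\<bar>)"
  proof (rule cSUP_least)
    fix x
    have "\<bar>?p x\<bar> \<le> (SUP x. \<bar>?p x\<bar>)" "\<bar>?q x\<bar> \<le> (SUP x. \<bar>?q x\<bar>)"
      by (rule cSUP_upper[OF UNIV_I bp(1)], rule cSUP_upper[OF UNIV_I bq(1)])
    then show "\<bar>?r x\<bar> \<le> (SUP x. \<bar>?p x\<bar>) + (SUP x. \<bar>?q x\<bar>)" by linarith
  qed simp
  have 2: "(SUP z. ?S ?r z) \<le> (SUP z. ?S ?p z) + (SUP z. ?S ?q z)"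
  proof (rule cSUP_least)
    fix z :: "'a \<times> 'a"
    obtain x y where z: "z = (x, y)" by force
    have "?S ?r z \<le> ?S ?p z + ?S ?q z"
      unfolding z prod.case add_divide_distrib[symmetric] by (rule divide_right_mono) auto
    moreover have "?S ?p z \<le> (SUP z. ?S ?p z)" "?S ?q z \<le> (SUP z. ?S ?q z)"
      by (rule cSUP_upper[OF UNIV_I bp(2)], rule cSUP_upper[OF UNIV_I bq(2)])
    ultimately show "?S ?r z \<le> (SUP z. ?S ?p z) + (SUP z. ?S ?q z)" by linarith
  qed simp
  show "holder_dist \<alpha> f h \<le> holder_dist \<alpha> f g + holder_dist \<alpha> g h"
    using 1 2 m by (simp add: holder_dist_def holder_norm_def)
qed

definition generic_in :: "'b topology \<Rightarrow> 'b set \<Rightarrow> bool" where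
  "generic_in X G \<longleftrightarrow>
     (\<exists>\<U>. countable \<U> \<and> (\<forall>U\<in>\<U>. openin X U \<and> X closure_of U = topspace X) \<and>
          topspace X \<inter> \<Inter>\<U> \<subseteq> G)"

text \<open>Addition on \<^typ>\<open>ereal\<close> has \<open>\<infinity> + (-\<infinity>) = \<infinity>\<close>, whereas in the max-plus
  semiring \<open>-\<infinity>\<close> is absorbing.\<close>

definition tmult :: "ereal \<Rightarrow> ereal \<Rightarrow> ereal" (infixl \<open>\<otimes>\<^sub>t\<close> 70) where
  "x \<otimes>\<^sub>t y = (if x = -\<infinity> \<or> y = -\<infinity> then -\<infinity> else x + y)"

text \<open>All function spaces consist of \<^typ>\<open>ereal\<close>-valued functions; \<open>cont_into S\<close> is \<open>C(X, S)\<close> for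
  the subspace topology on \<open>S\<close>, and \<open>range ereal\<close> is the real line.\<close>

definition cont_into :: "ereal set \<Rightarrow> ('a::topological_space \<Rightarrow> ereal) set" where
  "cont_into S = {u. continuous_on UNIV u \<and> range u \<subseteq> S}"

definition usc :: "('a::topological_space \<Rightarrow> ereal) \<Rightarrow> bool" where
  "usc b \<longleftrightarrow> (\<forall>c. open {x. b x < c})"

definition D_max :: "('a::topological_space \<Rightarrow> ereal) set" where
  "D_max = {b. usc b \<and> range b \<subseteq> range ereal \<union> {-\<infinity>}} \<union> {\<lambda>_. \<infinity>}"

definition bousch :: "('a \<Rightarrow> 'a) \<Rightarrow> ('a \<Rightarrow> real) \<Rightarrow> ('a \<Rightarrow> ereal) \<Rightarrow> 'a \<Rightarrow> ereal" where
  "bousch T B u = (\<lambda>x. SUP y \<in> T -` {x}. u y \<otimes>\<^sub>t ereal (B y))"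

definition adjoint_op :: "('a \<Rightarrow> 'a) \<Rightarrow> ('a \<Rightarrow> real) \<Rightarrow> ('a \<Rightarrow> ereal) \<Rightarrow> 'a \<Rightarrow> ereal" where
  "adjoint_op T A b = (\<lambda>x. b (T x) \<otimes>\<^sub>t ereal (A x))"

definition eigenfunction_for ::
    "('a::topological_space \<Rightarrow> 'a) \<Rightarrow> ('a \<Rightarrow> real) \<Rightarrow> ereal \<Rightarrow> ('a \<Rightarrow> ereal) \<Rightarrow> bool" where
  "eigenfunction_for T A \<kappa> u \<longleftrightarrow>
     u \<in> cont_into (range ereal) \<and> bousch T A u = (\<lambda>x. u x \<otimes>\<^sub>t \<kappa>)"

definition tropical_eigenvalue ::
    "('a::topological_space \<Rightarrow> 'a) \<Rightarrow> ('a \<Rightarrow> real) \<Rightarrow> ereal \<Rightarrow> bool" where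
  "tropical_eigenvalue T A \<kappa> \<longleftrightarrow> (\<exists>u. eigenfunction_for T A \<kappa> u)"

definition tropical_eigenfunction ::
    "('a::topological_space \<Rightarrow> 'a) \<Rightarrow> ('a \<Rightarrow> real) \<Rightarrow> ('a \<Rightarrow> ereal) \<Rightarrow> bool" where
  "tropical_eigenfunction T A u \<longleftrightarrow> (\<exists>\<kappa>. eigenfunction_for T A \<kappa> u)"

definition eigendensity_for ::
    "('a::topological_space \<Rightarrow> 'a) \<Rightarrow> ('a \<Rightarrow> real) \<Rightarrow> ereal \<Rightarrow> ('a \<Rightarrow> ereal) \<Rightarrow> bool" where
  "eigendensity_for T A \<kappa> b \<longleftrightarrow>
     b \<in> D_max - {\<lambda>_. \<infinity>, \<lambda>_. -\<infinity>} \<and> adjoint_op T A b = (\<lambda>x. b x \<otimes>\<^sub>t \<kappa>)"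

definition adjoint_eigenvalue ::
    "('a::topological_space \<Rightarrow> 'a) \<Rightarrow> ('a \<Rightarrow> real) \<Rightarrow> ereal \<Rightarrow> bool" where
  "adjoint_eigenvalue T A \<kappa> \<longleftrightarrow> (\<exists>b. eigendensity_for T A \<kappa> b)"

definition limsup_iterates ::
    "('a::topological_space \<Rightarrow> 'a) \<Rightarrow> ('a \<Rightarrow> real) \<Rightarrow> ('a \<Rightarrow> real) \<Rightarrow> 'a \<Rightarrow> ereal" where
  "limsup_iterates T A u =
     (\<lambda>x. limsup (\<lambda>n. (bousch T (\<lambda>y. A y - Q T A) ^^ n) (\<lambda>y. ereal (u y)) x))"

end

theory Submission
  imports Defs
begin

text \<open>
  Write \<open>B = A - Q\<close> and \<open>S n\<close> for the \<open>n\<close>-th Birkhoff sum of \<open>B\<close>.  Everything rests on three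
  elementary facts about an open distance-expanding map.

  \<^item> Orbit segments can be pulled back (\<open>pullback\<close>): a point near the end of a segment is the end of another
    segment which approaches the first one geometrically towards the past.  Hence Birkhoff sums of Hoelder
    functions along the two differ by a bounded multiple of a power of the final distance
    (\<open>birkhoff_distortion\<close>).
  \<^item> A segment which nearly returns to its start is shadowed by a periodic orbit (\<open>closing\<close>), whose
    equidistribution is an invariant measure.  Cutting an arbitrary segment into nearly closed pieces gives
    \<open>S n \<le> K\<close> with \<open>K\<close> independent of \<open>n\<close> and of the point (\<open>birkhoff_upper_bound\<close>).
  \<^item> Integrating \<open>S n\<close> against invariant measures shows that it is nonnegative somewhere, for each \<open>n\<close>
    (\<open>birkhoff_nonneg_somewhere\<close>).

  The upper bound makes \<open>v x = sup {S n y | T^n y = x}\<close>, taken over all \<open>n\<close> and \<open>y\<close>, finite and Hoelder, and \<open>B + v - v \<circ> T \<le> 0\<close>.  By the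
  third fact and compactness there is a contact orbit, along which this function vanishes
  (\<open>contact_orbit\<close>).  The function \<open>inf_n (S n - v \<circ> T^n)\<close>, a decreasing limit of continuous functions, is then
  an eigen-density for \<open>Q\<close>.  Every other eigenvalue of the adjoint is at most \<open>Q\<close> because a density is bounded
  above and the \<open>S n\<close> are too.

  The iterates of the Bousch operator are suprema of \<open>u + S n\<close> over preimages of order \<open>n\<close>.  The pullback
  makes them locally Hoelder with constants independent of \<open>n\<close>, which passes to the limsup; since
  preimage sets are finite, the limsup satisfies the eigenfunction equation.  Its finiteness set is clopen, forward
  invariant and, by the contact orbit, nonempty, so it is the whole space if \<open>T\<close> is transitive.

  Generic uniqueness avoids maximising measures.  \<open>Q\<close> is convex and Lipschitz in the potential, so
  a generic potential has no kink in countably many prescribed directions, chosen as distances to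
  finite sets.  If \<open>S n\<close> is bounded below at \<open>y\<close> and at \<open>z\<close>, the averages of such a direction along both orbits
  are slopes supporting \<open>Q\<close>, so they coincide, and the two orbits must come arbitrarily close (\<open>small_kinks_linked\<close>).
  This forces uniqueness.  The difference of two eigenfunctions is constant along accumulation points of
  calibrated backward orbits, and all these constants agree (\<open>eigenfunction_unique\<close>).  For a density, pulling
  the orbit of \<open>y\<close> back along that of \<open>z\<close> transports a lower bound from \<open>y\<close> to \<open>z\<close>
  (\<open>density_transport\<close>), which pins the density down to a constant (\<open>density_unique\<close>).
\<close>

section \<open>Hoelder functions\<close>

lemma holder_spaceE:
  assumes "f \<in> holder_space \<alpha>"
  obtains C where "0 \<le> C" "\<And>x y. \<bar>f x - f y\<bar> \<le> C * dist x y powr \<alpha>"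
proof -
  obtain C where C: "\<And>x y. \<bar>f x - f y\<bar> \<le> C * dist x y powr \<alpha>"
    using assms unfolding holder_space_def by blast
  have "\<bar>f x - f y\<bar> \<le> max C 0 * dist x y powr \<alpha>" for x y
    by (rule order_trans[OF C]) (auto intro!: mult_right_mono)
  then show ?thesis using that[of "max C 0"] by simp
qed

lemma holder_spaceI: "(\<And>x y. \<bar>f x - f y\<bar> \<le> C * dist x y powr \<alpha>) \<Longrightarrow> f \<in> holder_space \<alpha>"
  unfolding holder_space_def by blast

lemma holder_space_const: "(\<lambda>_. c) \<in> holder_space \<alpha>"
  by (rule holder_spaceI[of _ 0]) simp

lemma holder_space_scale:
  assumes "f \<in> holder_space \<alpha>" shows "(\<lambda>x. c * f x) \<in> holder_space \<alpha>"
proof -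
  obtain C where C: "0 \<le> C" "\<And>x y. \<bar>f x - f y\<bar> \<le> C * dist x y powr \<alpha>"
    using holder_spaceE[OF assms] by blast
  have "\<bar>c * f x - c * f y\<bar> \<le> (\<bar>c\<bar> * C) * dist x y powr \<alpha>" for x y
    using mult_left_mono[OF C(2)[of x y], of "\<bar>c\<bar>"]
    by (simp add: abs_mult right_diff_distrib[symmetric] mult.assoc)
  then show ?thesis by (rule holder_spaceI)
qed

lemma holder_space_add:
  assumes "f \<in> holder_space \<alpha>" "g \<in> holder_space \<alpha>"
  shows "(\<lambda>x. f x + g x) \<in> holder_space \<alpha>"
  using holder_space_diff[OF assms(1) holder_space_scale[OF assms(2), of "-1"]] by simp

lemma holder_continuous:
  assumes "f \<in> holder_space \<alpha>" "0 < \<alpha>"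
  shows "continuous_on UNIV f"
proof -
  obtain C where C: "0 \<le> C" "\<And>x y. \<bar>f x - f y\<bar> \<le> C * dist x y powr \<alpha>"
    using holder_spaceE[OF assms(1)] by blast
  have "(f \<longlongrightarrow> f x) (at x)" for x
  proof -
    have "((\<lambda>y. C * dist y x powr \<alpha>) \<longlongrightarrow> C * dist x x powr \<alpha>) (at x)"
      using assms(2) by (intro tendsto_intros) auto
    then have 0: "((\<lambda>y. C * dist y x powr \<alpha>) \<longlongrightarrow> 0) (at x)" using assms(2) by simp
    have "((\<lambda>y. f y - f x) \<longlongrightarrow> 0) (at x)"
      by (rule Lim_null_comparison[OF _ 0]) (use C(2) in auto)
    then show ?thesis by (rule LIM_zero_cancel)
  qed
  then show ?thesis by (simp add: continuous_on_def)
qed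

text \<open>Far apart points are harmless: the sup norm controls their contribution.\<close>

lemma holder_space_local:
  fixes f :: "'a::metric_space \<Rightarrow> real"
  assumes loc: "\<And>x y. dist x y < r \<Longrightarrow> \<bar>f x - f y\<bar> \<le> C * dist x y powr \<alpha>"
    and bound: "\<And>x. \<bar>f x\<bar> \<le> K" and "0 < r" "0 < \<alpha>"
  shows "f \<in> holder_space \<alpha>"
proof (rule holder_spaceI)
  fix x y
  have rp: "r powr \<alpha> > 0" using \<open>0 < r\<close> by simp
  have K: "K \<ge> 0" using bound[of x] by linarith
  show "\<bar>f x - f y\<bar> \<le> max C (2 * K / r powr \<alpha>) * dist x y powr \<alpha>"
  proof (cases "dist x y < r")
    case True
    show ?thesis by (rule order_trans[OF loc[OF True]]) (auto intro!: mult_right_mono)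
  next
    case False
    then have "r powr \<alpha> \<le> dist x y powr \<alpha>" using assms by (intro powr_mono2) auto
    then have "2 * K / r powr \<alpha> * r powr \<alpha> \<le> max C (2 * K / r powr \<alpha>) * dist x y powr \<alpha>"
      using K rp by (intro mult_mono max.cobounded2) (auto simp: le_max_iff_disj)
    moreover have "\<bar>f x - f y\<bar> \<le> 2 * K" using bound[of x] bound[of y] by linarith
    ultimately show ?thesis using rp by simp
  qed
qed

lemma lipschitz_holder:
  fixes f :: "'a::metric_space \<Rightarrow> real"
  assumes cpt: "compact (UNIV :: 'a set)" and lip: "\<And>x y. \<bar>f x - f y\<bar> \<le> dist x y"
    and "0 < \<alpha>" "\<alpha> \<le> 1"
  shows "f \<in> holder_space \<alpha>"
proof -
  have "continuous_on UNIV f"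
    unfolding continuous_on_iff using lip by (metis dist_real_def order_le_less_trans)
  then have "bounded (range f)"
    using compact_continuous_image[OF _ cpt] compact_imp_bounded by blast
  then obtain K where K: "\<And>x. \<bar>f x\<bar> \<le> K" unfolding bounded_iff by auto
  show ?thesis
  proof (rule holder_space_local[where r = 1 and C = 1])
    fix x y :: 'a assume d: "dist x y < 1"
    have "dist x y \<le> dist x y powr \<alpha>"
    proof (cases "dist x y = 0")
      case False
      then have "dist x y powr 1 \<le> dist x y powr \<alpha>" using d assms by (intro powr_mono') auto
      then show ?thesis using False by simp
    qed simp
    then show "\<bar>f x - f y\<bar> \<le> 1 * dist x y powr \<alpha>" using lip[of x y] by linarith
  qed (use K assms in auto)
qed

section \<open>Birkhoff sums and iterates of the Bousch operator\<close>

definition birkhoff_sum :: "('a \<Rightarrow> 'a) \<Rightarrow> ('a \<Rightarrow> real) \<Rightarrow> nat \<Rightarrow> 'a \<Rightarrow> real" where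
  "birkhoff_sum T f n x = (\<Sum>i<n. f ((T ^^ i) x))"

lemma birkhoff_0 [simp]: "birkhoff_sum T f 0 x = 0"
  by (simp add: birkhoff_sum_def)

lemma birkhoff_Suc: "birkhoff_sum T f (Suc n) x = birkhoff_sum T f n x + f ((T ^^ n) x)"
  by (simp add: birkhoff_sum_def)

lemma birkhoff_add_time:
  "birkhoff_sum T f (m + n) x = birkhoff_sum T f m x + birkhoff_sum T f n ((T ^^ m) x)"
proof (induction n)
  case (Suc n)
  have "(T ^^ n) ((T ^^ m) x) = (T ^^ (m + n)) x" by (simp add: funpow_add add.commute[of m n])
  then show ?case using Suc by (simp add: birkhoff_Suc)
qed simp

lemma birkhoff_diff_const:
  "birkhoff_sum T (\<lambda>x. f x - c) n x = birkhoff_sum T f n x - real n * c"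
  by (simp add: birkhoff_sum_def sum_subtractf)

lemma birkhoff_add_scale:
  "birkhoff_sum T (\<lambda>x. f x + t * g x) n x = birkhoff_sum T f n x + t * birkhoff_sum T g n x"
  by (simp add: birkhoff_sum_def sum.distrib sum_distrib_left)

lemma birkhoff_coboundary:
  "birkhoff_sum T (\<lambda>x. f x + v x - v (T x)) n x = birkhoff_sum T f n x + v x - v ((T ^^ n) x)"
  by (induction n) (simp_all add: birkhoff_Suc)

lemma birkhoff_subaction_le:
  assumes "\<And>x. f x + v x \<le> v (T x)"
  shows "birkhoff_sum T f n x + v x \<le> v ((T ^^ n) x)"
proof (induction n)
  case (Suc n)
  then show ?case using assms[of "(T ^^ n) x"] by (simp add: birkhoff_Suc)
qed simp

lemma birkhoff_calibrated_preimage: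
  assumes "\<And>x. \<exists>y. T y = x \<and> w x = f y + w y"
  shows "\<exists>y. (T ^^ n) y = x \<and> w x = birkhoff_sum T f n y + w y"
proof (induction n arbitrary: x)
  case (Suc n)
  obtain y where y: "T y = x" "w x = f y + w y" using assms by blast
  obtain z where z: "(T ^^ n) z = y" "w y = birkhoff_sum T f n z + w z" using Suc by blast
  show ?case by (rule exI[of _ z]) (use y z in \<open>simp add: birkhoff_Suc\<close>)
qed simp

lemma tmult_real [simp]: "x \<otimes>\<^sub>t ereal c = x + ereal c"
  by (simp add: tmult_def)

text \<open>Unfolding the operator turns its iterates into an optimisation over preimages of order \<open>n\<close>; with no such
  preimage the supremum is \<open>-\<infinity>\<close> on both sides.\<close>

lemma bousch_iterate:
  "(bousch T B ^^ n) (\<lambda>y. ereal (u y)) x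
     = (SUP y\<in>{y. (T ^^ n) y = x}. ereal (u y + birkhoff_sum T B n y))"
proof (induction n arbitrary: x)
  case 0
  have "{y. y = x} = {x}" by auto
  then show ?case by simp
next
  case (Suc n)
  let ?g = "\<lambda>n y. ereal (u y + birkhoff_sum T B n y)"
  let ?L = "\<lambda>y. SUP z\<in>{z. (T ^^ n) z = y}. ?g n z"
  have "(bousch T B ^^ Suc n) (\<lambda>y. ereal (u y)) x = (SUP y\<in>T -` {x}. ?L y + ereal (B y))"
    by (simp add: bousch_def Suc)
  also have "\<dots> = (SUP z\<in>{z. (T ^^ Suc n) z = x}. ?g (Suc n) z)" (is "?l = ?r")
  proof (rule antisym)
    show "?l \<le> ?r"
    proof (rule SUP_least)
      fix y assume y: "y \<in> T -` {x}"
      have "?L y \<le> ?r - ereal (B y)"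
      proof (rule SUP_least)
        fix z assume z: "z \<in> {z. (T ^^ n) z = y}"
        have "?g (Suc n) z \<le> ?r" using y z by (intro SUP_upper) auto
        moreover have "?g (Suc n) z = ?g n z + ereal (B y)" using z by (simp add: birkhoff_Suc)
        ultimately show "?g n z \<le> ?r - ereal (B y)" by (simp add: ereal_le_minus_iff)
      qed
      then show "?L y + ereal (B y) \<le> ?r" by (simp add: ereal_le_minus_iff)
    qed
    show "?r \<le> ?l"
    proof (rule SUP_least)
      fix z assume z: "z \<in> {z. (T ^^ Suc n) z = x}"
      define y where "y = (T ^^ n) z"
      have "?g n z + ereal (B y) \<le> ?L y + ereal (B y)"
        by (intro add_right_mono SUP_upper) (simp add: y_def)
      also have "\<dots> \<le> ?l" using z by (intro SUP_upper) (simp add: y_def)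
      finally show "?g (Suc n) z \<le> ?l" by (simp add: birkhoff_Suc y_def add.assoc)
    qed
  qed
  finally show ?case .
qed

section \<open>Inverse branches, distortion and closing\<close>

text \<open>Openness enters through \<open>lift\<close> alone: inverse branches exist on balls of a uniform radius \<open>\<xi>\<close> and
  contract by the factor \<open>1 / l\<close>.  With \<open>\<xi> \<le> \<eta>\<close>, two lifts near the same point are within the range of \<open>expand\<close>.\<close>

locale open_expanding_map =
  fixes T :: "'a::metric_space \<Rightarrow> 'a" and l \<eta> \<xi> \<alpha> :: real
  assumes compact_space: "compact (UNIV :: 'a set)"
    and cont_T: "continuous_on UNIV T"
    and l_gt_1: "1 < l"
    and expand: "dist x y \<le> 2 * \<eta> \<Longrightarrow> l * dist x y \<le> dist (T x) (T y)"
    and \<xi>_pos: "0 < \<xi>" and \<xi>_le: "\<xi> \<le> \<eta>"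
    and lift: "dist (T x) y < \<xi> \<Longrightarrow> \<exists>z. T z = y \<and> l * dist x z \<le> dist (T x) y"
    and \<alpha>_pos: "0 < \<alpha>" and \<alpha>_le: "\<alpha> \<le> 1"

text \<open>The radius \<open>\<xi>\<close> exists by compactness: if it did not, points \<open>x\<^sub>n\<close> accumulating at \<open>a\<close> would have images whose
  arbitrarily small neighbourhoods escape \<open>T\<close> of a fixed ball, although \<open>T a\<close> is interior to that image.\<close>

lemma open_expanding_mapI:
  fixes T :: "'a::metric_space \<Rightarrow> 'a"
  assumes cpt: "compact (UNIV :: 'a set)" and cont: "continuous_on UNIV T"
    and opn: "open_map_on_space T" and "distance_expanding T" and "0 < \<alpha>" "\<alpha> \<le> 1"
  obtains l \<eta> \<xi> where "open_expanding_map T l \<eta> \<xi> \<alpha>"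
proof -
  obtain l \<eta> where l: "1 < l" "0 < \<eta>"
    and ex: "\<And>x y. dist x y \<le> 2 * \<eta> \<Longrightarrow> l * dist x y \<le> dist (T x) (T y)"
    using assms(4) unfolding distance_expanding_def by blast
  have "\<exists>r>0. \<forall>x y. dist (T x) y < r \<longrightarrow> y \<in> T ` ball x (2 * \<eta>)"
  proof (rule ccontr)
    assume "\<not> ?thesis"
    then have "\<forall>n. \<exists>x y. dist (T x) y < 1 / Suc n \<and> y \<notin> T ` ball x (2 * \<eta>)"
      by (meson zero_less_divide_1_iff of_nat_0_less_iff zero_less_Suc)
    then obtain x y where xy: "\<And>n. dist (T (x n)) (y n) < 1 / Suc n"
        "\<And>n. y n \<notin> T ` ball (x n) (2 * \<eta>)" by metis
    obtain a r where r: "strict_mono r" "(x \<circ> r) \<longlonglongrightarrow> a"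
      using cpt[unfolded compact_def] by (metis UNIV_I)
    have Tx: "(\<lambda>n. T (x (r n))) \<longlonglongrightarrow> T a"
      using continuous_on_tendsto_compose[OF cont r(2)] by (simp add: comp_def)
    have 0: "(\<lambda>n. dist (T (x (r n))) (y (r n))) \<longlonglongrightarrow> 0"
    proof (rule tendsto_sandwich[OF _ _ tendsto_const])
      show "(\<lambda>n. 1 / real (Suc (r n))) \<longlonglongrightarrow> 0"
        using LIMSEQ_subseq_LIMSEQ[OF LIMSEQ_inverse_real_of_nat r(1)]
        by (simp add: comp_def inverse_eq_divide)
      show "\<forall>\<^sub>F n in sequentially. dist (T (x (r n))) (y (r n)) \<le> 1 / real (Suc (r n))"
        using xy(1) by (intro always_eventually) (auto intro: less_imp_le)
    qed simp
    have yl: "(\<lambda>n. y (r n)) \<longlonglongrightarrow> T a"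
    proof (rule iffD2[OF tendsto_dist_iff], rule tendsto_sandwich[OF _ _ tendsto_const])
      show "(\<lambda>n. dist (T (x (r n))) (y (r n)) + dist (T (x (r n))) (T a)) \<longlonglongrightarrow> 0"
        using tendsto_add[OF 0 iffD1[OF tendsto_dist_iff Tx]] by simp
      show "\<forall>\<^sub>F n in sequentially. dist (y (r n)) (T a)
          \<le> dist (T (x (r n))) (y (r n)) + dist (T (x (r n))) (T a)"
        by (intro always_eventually allI) (metis dist_commute dist_triangle)
    qed simp
    have "open (T ` ball a \<eta>)" using opn by (simp add: open_map_on_space_def)
    moreover have "T a \<in> T ` ball a \<eta>" using l by simp
    ultimately have "\<forall>\<^sub>F n in sequentially. y (r n) \<in> T ` ball a \<eta>"
      using yl by (simp add: tendsto_def)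
    moreover have "\<forall>\<^sub>F n in sequentially. dist (x (r n)) a < \<eta>"
      using r(2) l(2) by (simp add: tendsto_iff comp_def)
    ultimately obtain n where n: "y (r n) \<in> T ` ball a \<eta>" "dist (x (r n)) a < \<eta>"
      using eventually_happens'[OF sequentially_bot eventually_conj] by blast
    have "ball a \<eta> \<subseteq> ball (x (r n)) (2 * \<eta>)"
    proof
      fix z assume "z \<in> ball a \<eta>"
      then show "z \<in> ball (x (r n)) (2 * \<eta>)"
        using n(2) dist_triangle[of "x (r n)" z a] by simp
    qed
    then show False using n(1) xy(2)[of "r n"] by blast
  qed
  then obtain \<rho> where \<rho>: "\<rho> > 0" "\<And>x y. dist (T x) y < \<rho> \<Longrightarrow> y \<in> T ` ball x (2 * \<eta>)" by blast
  have "open_expanding_map T l \<eta> (min \<rho> \<eta>) \<alpha>"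
  proof
    fix x y assume "dist (T x) y < min \<rho> \<eta>"
    then obtain z where "dist x z < 2 * \<eta>" "T z = y" using \<rho>(2)[of x y] by auto
    then show "\<exists>z. T z = y \<and> l * dist x z \<le> dist (T x) y" using ex[of x z] by auto
  qed (use assms l ex \<rho>(1) in auto)
  then show ?thesis by (rule that)
qed

context open_expanding_map
begin

abbreviation S :: "('a \<Rightarrow> real) \<Rightarrow> nat \<Rightarrow> 'a \<Rightarrow> real" where
  "S \<equiv> birkhoff_sum T"

lemma bounded_continuous:
  fixes f :: "'a \<Rightarrow> real"
  assumes "continuous_on UNIV f"
  obtains K where "0 \<le> K" "\<And>x. \<bar>f x\<bar> \<le> K"
proof -
  have "bounded (range f)"
    using compact_continuous_image[OF assms compact_space] compact_imp_bounded by blast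
  then obtain K where "\<And>x. \<bar>f x\<bar> \<le> K" unfolding bounded_iff by auto
  then show ?thesis using that[of K] by (meson abs_ge_zero order_trans)
qed

lemma continuous_iterate: "continuous_on UNIV (T ^^ n)"
proof (induction n)
  case (Suc n)
  then show ?case using continuous_on_compose2[OF cont_T Suc] by (simp add: comp_def)
qed simp

text \<open>Inverse branches are composed along the orbit of \<open>x\<close>, from the end to the start; the remaining
  distance is contracted at each step and so stays below \<open>\<xi>\<close>.\<close>

lemma pullback:
  assumes "dist ((T ^^ n) x) y < \<xi>"
  obtains z where "(T ^^ n) z = y"
    "\<And>i. i \<le> n \<Longrightarrow> l ^ (n - i) * dist ((T ^^ i) x) ((T ^^ i) z) \<le> dist ((T ^^ n) x) y"
proof -
  have "\<exists>z. (T ^^ n) z = y \<and>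
      (\<forall>i\<le>n. l ^ (n - i) * dist ((T ^^ i) x) ((T ^^ i) z) \<le> dist ((T ^^ n) x) y)"
    using assms
  proof (induction n arbitrary: x)
    case (Suc n)
    let ?d = "dist ((T ^^ Suc n) x) y"
    have sw: "(T ^^ Suc k) w = (T ^^ k) (T w)" for k w by (simp add: funpow_swap1)
    obtain z' where z': "(T ^^ n) z' = y"
      "\<And>i. i \<le> n \<Longrightarrow> l ^ (n - i) * dist ((T ^^ i) (T x)) ((T ^^ i) z') \<le> ?d"
      using Suc.IH[of "T x"] Suc.prems unfolding sw by blast
    have "1 * dist (T x) z' \<le> l ^ n * dist (T x) z'"
      using l_gt_1 by (intro mult_right_mono one_le_power) auto
    then have "dist (T x) z' < \<xi>" using z'(2)[of 0] Suc.prems by simp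
    then obtain z where z: "T z = z'" "l * dist x z \<le> dist (T x) z'" using lift by blast
    have "l ^ (Suc n - i) * dist ((T ^^ i) x) ((T ^^ i) z) \<le> ?d" if "i \<le> Suc n" for i
    proof (cases i)
      case 0
      have "l ^ n * (l * dist x z) \<le> l ^ n * dist (T x) z'"
        using z(2) l_gt_1 by (intro mult_left_mono) auto
      then show ?thesis using z'(2)[of 0] 0 by (simp add: mult.assoc mult.left_commute)
    next
      case (Suc j)
      have "(T ^^ i) x = (T ^^ j) (T x)" "(T ^^ i) z = (T ^^ j) z'" "Suc n - i = n - j"
        by (simp_all only: Suc sw z(1) diff_Suc_Suc)
      then show ?thesis using z'(2)[of j] that Suc by (simp only: Suc_le_mono)
    qed
    moreover have "(T ^^ Suc n) z = y" unfolding sw z(1) by (rule z'(1))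
    ultimately show ?case by blast
  qed auto
  then show ?thesis using that by blast
qed

text \<open>The sum of the geometric series of contraction factors of a Hoelder modulus.\<close>

definition distortion :: real where
  "distortion = 1 / (1 - l powr (-\<alpha>))"

lemma distortion_pos: "0 < distortion"
  using l_gt_1 \<alpha>_pos by (simp add: distortion_def powr_less_one)

lemma geometric_shadow_sum: "(\<Sum>i<n. (l powr (-\<alpha>)) ^ (n - i)) \<le> distortion"
proof -
  define t where "t = l powr (-\<alpha>)"
  have t: "0 < t" "t < 1" using l_gt_1 \<alpha>_pos by (auto simp: t_def powr_less_one)
  have "(\<Sum>i<n. t ^ (n - i)) \<le> (\<Sum>i<n. t ^ (n - Suc i))"
    using t by (intro sum_mono power_decreasing) auto
  also have "\<dots> = (\<Sum>i<n. t ^ i)" by (rule sum.nat_diff_reindex)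
  also have "\<dots> \<le> (\<Sum>i. t ^ i)" using t by (intro sum_le_suminf summable_geometric) auto
  also have "\<dots> = 1 / (1 - t)" using t by (intro suminf_geometric) auto
  finally show ?thesis by (simp add: distortion_def t_def)
qed

lemma birkhoff_distortion:
  assumes f: "0 \<le> C" "\<And>x y. \<bar>f x - f y\<bar> \<le> C * dist x y powr \<alpha>"
    and d: "\<And>i. i \<le> n \<Longrightarrow> l ^ (n - i) * dist ((T ^^ i) x) ((T ^^ i) z) \<le> d"
  shows "\<bar>S f n x - S f n z\<bar> \<le> C * distortion * d powr \<alpha>"
proof -
  have d0: "0 \<le> d" using order_trans[OF _ d[of n]] by simp
  have one_step: "\<bar>f ((T ^^ i) x) - f ((T ^^ i) z)\<bar> \<le> C * d powr \<alpha> * (l powr (-\<alpha>)) ^ (n - i)"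
    if "i < n" for i
  proof -
    have lp: "l ^ (n - i) > 0" using l_gt_1 by simp
    have "dist ((T ^^ i) x) ((T ^^ i) z) \<le> d / l ^ (n - i)"
      using d[of i] that lp by (simp add: field_simps)
    then have "dist ((T ^^ i) x) ((T ^^ i) z) powr \<alpha> \<le> (d / l ^ (n - i)) powr \<alpha>"
      using \<alpha>_pos by (intro powr_mono2) auto
    also have "\<dots> = d powr \<alpha> * (l powr (-\<alpha>)) ^ (n - i)"
    proof -
      have "(l ^ (n - i)) powr \<alpha> = (l powr \<alpha>) ^ (n - i)"
        using l_gt_1 by (simp add: powr_power powr_realpow[symmetric] powr_powr mult.commute)
      then show ?thesis
        using d0 l_gt_1 by (simp add: powr_divide powr_minus_divide power_one_over)
    qed
    finally have "C * dist ((T ^^ i) x) ((T ^^ i) z) powr \<alpha> \<le> C * (d powr \<alpha> * (l powr (-\<alpha>)) ^ (n - i))"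
      using f(1) by (rule mult_left_mono)
    then show ?thesis using f(2) order_trans by (fastforce simp: mult.assoc)
  qed
  have "\<bar>S f n x - S f n z\<bar> = \<bar>\<Sum>i<n. f ((T ^^ i) x) - f ((T ^^ i) z)\<bar>"
    by (simp add: birkhoff_sum_def sum_subtractf)
  also have "\<dots> \<le> (\<Sum>i<n. \<bar>f ((T ^^ i) x) - f ((T ^^ i) z)\<bar>)" by (rule sum_abs)
  also have "\<dots> \<le> (\<Sum>i<n. C * d powr \<alpha> * (l powr (-\<alpha>)) ^ (n - i))"
    by (intro sum_mono one_step) simp
  also have "\<dots> = C * d powr \<alpha> * (\<Sum>i<n. (l powr (-\<alpha>)) ^ (n - i))" by (simp add: sum_distrib_left)
  also have "\<dots> \<le> C * d powr \<alpha> * distortion"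
    using f(1) by (intro mult_left_mono geometric_shadow_sum) auto
  finally show ?thesis by (simp add: mult_ac)
qed

text \<open>The inverse branch of \<open>T^n\<close> along the orbit of \<open>x\<close> is a contraction, and the assumed closeness makes it map
  the ball of radius \<open>\<xi> / 2\<close> about \<open>T^n x\<close> into itself: the image lies within \<open>\<xi> / (2 l)\<close> of \<open>x\<close>.  Its fixed
  point is the periodic point.\<close>

lemma closing:
  assumes "0 < n" and close: "dist ((T ^^ n) x) x \<le> \<xi> / 2 * (1 - 1 / l)"
  obtains p where "(T ^^ n) p = p"
    "\<And>i. i \<le> n \<Longrightarrow> l ^ (n - i) * dist ((T ^^ i) x) ((T ^^ i) p) \<le> \<xi> / 2"
proof -
  let ?r = "\<xi> / 2" and ?K = "cball ((T ^^ n) x) (\<xi> / 2)"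
  have "\<forall>y\<in>?K. \<exists>z. (T ^^ n) z = y \<and>
     (\<forall>i\<le>n. l ^ (n - i) * dist ((T ^^ i) x) ((T ^^ i) z) \<le> ?r)"
  proof
    fix y assume y: "y \<in> ?K"
    then have "dist ((T ^^ n) x) y < \<xi>" using \<xi>_pos by simp
    from pullback[OF this] obtain z where z: "(T ^^ n) z = y"
      "\<And>i. i \<le> n \<Longrightarrow> l ^ (n - i) * dist ((T ^^ i) x) ((T ^^ i) z) \<le> dist ((T ^^ n) x) y" by blast
    then show "\<exists>z. (T ^^ n) z = y \<and>
       (\<forall>i\<le>n. l ^ (n - i) * dist ((T ^^ i) x) ((T ^^ i) z) \<le> ?r)"
      using z(1) order_trans[OF z(2)] y unfolding mem_cball by blast
  qed
  then obtain g where g: "\<And>y. y \<in> ?K \<Longrightarrow> (T ^^ n) (g y) = y"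
    "\<And>y i. y \<in> ?K \<Longrightarrow> i \<le> n \<Longrightarrow> l ^ (n - i) * dist ((T ^^ i) x) ((T ^^ i) (g y)) \<le> ?r"
    by metis
  have ln: "l \<le> l ^ n" using l_gt_1 \<open>0 < n\<close> by (intro self_le_power) auto
  have near: "dist ((T ^^ i) x) ((T ^^ i) (g y)) \<le> ?r" if "y \<in> ?K" "i \<le> n" for y i
  proof -
    have "1 * dist ((T ^^ i) x) ((T ^^ i) (g y)) \<le> l ^ (n - i) * dist ((T ^^ i) x) ((T ^^ i) (g y))"
      using l_gt_1 by (intro mult_right_mono one_le_power) auto
    then show ?thesis using g(2)[OF that] by simp
  qed
  have self: "g ` ?K \<subseteq> ?K"
  proof safe
    fix y assume y: "y \<in> ?K"
    have "l * dist x (g y) \<le> l ^ n * dist x (g y)" using ln by (intro mult_right_mono) auto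
    then have "l * dist x (g y) \<le> ?r" using g(2)[OF y, of 0] by simp
    then have "dist x (g y) \<le> ?r / l" using l_gt_1 by (simp add: field_simps)
    then have "dist ((T ^^ n) x) (g y) \<le> ?r * (1 - 1 / l) + ?r / l"
      using dist_triangle[of "(T ^^ n) x" "g y" x] close by linarith
    also have "\<dots> = ?r" using l_gt_1 by (simp add: field_simps)
    finally show "g y \<in> ?K" by simp
  qed
  \<comment> \<open>Both lifts stay within \<open>\<eta>\<close> of the orbit of \<open>x\<close>, hence within \<open>2 \<eta>\<close> of each other, where \<open>T\<close> expands.\<close>
  have contr: "dist (g y) (g y') \<le> 1 / l * dist y y'" if y: "y \<in> ?K" "y' \<in> ?K" for y y'
  proof -
    have "l ^ i * dist (g y) (g y') \<le> dist ((T ^^ i) (g y)) ((T ^^ i) (g y'))" if "i \<le> n" for i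
      using that
    proof (induction i)
      case (Suc i)
      let ?a = "(T ^^ i) (g y)" and ?b = "(T ^^ i) (g y')"
      have "dist ?a ?b \<le> dist ?a ((T ^^ i) x) + dist ((T ^^ i) x) ?b" by (rule dist_triangle)
      also have "\<dots> \<le> ?r + ?r"
        using near[OF y(1), of i] near[OF y(2), of i] Suc.prems
        by (intro add_mono) (auto simp: dist_commute)
      also have "\<dots> \<le> 2 * \<eta>" using \<xi>_le \<xi>_pos by simp
      finally have "l * dist ?a ?b \<le> dist (T ?a) (T ?b)" by (rule expand)
      moreover have "l * (l ^ i * dist (g y) (g y')) \<le> l * dist ?a ?b"
        using Suc l_gt_1 by (intro mult_left_mono) auto
      ultimately show ?case by (simp add: mult.assoc)
    qed simp
    from this[of n] have "l ^ n * dist (g y) (g y') \<le> dist y y'" using g(1) y by simp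
    moreover have "l * dist (g y) (g y') \<le> l ^ n * dist (g y) (g y')"
      using ln by (intro mult_right_mono) auto
    ultimately show ?thesis using l_gt_1 by (simp add: field_simps)
  qed
  have "compact ?K" using compact_space closed_cball compact_Int_closed[of UNIV] by fastforce
  then have "\<exists>!p\<in>?K. g p = p"
    using l_gt_1 \<xi>_pos self contr
    by (intro Banach_fix[OF compact_imp_complete, where c = "1 / l"]) auto
  then obtain p where "p \<in> ?K" "g p = p" by blast
  then show ?thesis using that[of p] g by metis
qed

end

section \<open>Invariant measures and the maximal ergodic average\<close>

context open_expanding_map
begin

lemma measurable_T: "T \<in> borel_measurable borel"
  using cont_T by (rule borel_measurable_continuous_onI)

lemma invariant_integrable:
  fixes f :: "'a \<Rightarrow> real"
  assumes M: "M \<in> invariant_probs T" and f: "continuous_on UNIV f"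
  shows "integrable M f"
proof -
  interpret prob_space M using M by (simp add: invariant_probs_def)
  have [measurable_cong]: "sets M = sets borel" using M by (simp add: invariant_probs_def)
  obtain K where K: "\<And>x. \<bar>f x\<bar> \<le> K" using bounded_continuous[OF f] by blast
  have [measurable]: "f \<in> borel_measurable borel" using f by (rule borel_measurable_continuous_onI)
  show ?thesis by (rule integrable_const_bound[where B = K]) (use K in auto)
qed

lemma invariant_integral_iterate:
  fixes f :: "'a \<Rightarrow> real"
  assumes M: "M \<in> invariant_probs T" and f: "continuous_on UNIV f"
  shows "(\<integral>x. f ((T ^^ n) x) \<partial>M) = (\<integral>x. f x \<partial>M)"
proof (induction n)
  case (Suc n)
  have sets: "sets M = sets borel" and inv: "distr M borel T = M"
    using M by (auto simp: invariant_probs_def)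
  have c: "continuous_on UNIV (\<lambda>x. f ((T ^^ n) x))"
    using continuous_on_compose2[OF f continuous_iterate] by simp
  have "(\<integral>x. f ((T ^^ n) x) \<partial>M) = (\<integral>x. f ((T ^^ n) x) \<partial>distr M borel T)" by (simp add: inv)
  also have "\<dots> = (\<integral>x. f ((T ^^ n) (T x)) \<partial>M)"
    using c measurable_T measurable_cong_sets[OF sets refl]
    by (intro integral_distr borel_measurable_continuous_onI) auto
  finally show ?case using Suc by (simp add: funpow_swap1)
qed simp

lemma invariant_integral_birkhoff:
  assumes M: "M \<in> invariant_probs T" and f: "continuous_on UNIV f"
  shows "(\<integral>x. S f n x \<partial>M) = real n * (\<integral>x. f x \<partial>M)"
proof -
  have "integrable M (\<lambda>x. f ((T ^^ i) x))" for i
    by (rule invariant_integrable[OF M]) (use continuous_on_compose2[OF f continuous_iterate] in simp)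
  then show ?thesis
    unfolding birkhoff_sum_def
    by (subst Bochner_Integration.integral_sum) (simp_all add: invariant_integral_iterate[OF M f])
qed

lemma continuous_birkhoff:
  assumes "continuous_on UNIV f" shows "continuous_on UNIV (S f n)"
  unfolding birkhoff_sum_def
  by (intro continuous_intros continuous_on_compose2[OF assms continuous_iterate]) auto

text \<open>These are the only invariant measures that have to be exhibited: nearly closed orbit segments are
  shadowed by periodic orbits, which suffices to bound all Birkhoff sums in terms of \<open>Q\<close>.\<close>

lemma periodic_orbit_measure:
  assumes n: "0 < n" and p: "(T ^^ n) p = p"
  obtains M where "M \<in> invariant_probs T"
    "\<And>f::'a \<Rightarrow> real. continuous_on UNIV f \<Longrightarrow> (\<integral>x. f x \<partial>M) = S f n p / real n"
proof -
  define P where "P = pmf_of_set {..<n}"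
  define M where "M = distr (measure_pmf P) borel (\<lambda>i. (T ^^ i) p)"
  \<comment> \<open>\<open>T\<close> acts on the orbit as this cyclic shift of time, which preserves the uniform distribution.\<close>
  define s where "s i = (i + 1) mod n" for i
  have set_P: "set_pmf P = {..<n}" using n by (simp add: P_def lessThan_empty_iff)
  have "inj_on s {..<n}"
  proof (rule inj_onI)
    fix i j assume ij: "i \<in> {..<n}" "j \<in> {..<n}" "s i = s j"
    then show "i = j"
      by (cases "i + 1 = n"; cases "j + 1 = n") (auto simp: s_def)
  qed
  moreover have "s ` {..<n} \<subseteq> {..<n}" using n by (auto simp: s_def)
  ultimately have "bij_betw s {..<n} {..<n}"
    by (simp add: bij_betw_def endo_inj_surj)
  then have shift: "map_pmf s P = P"
    unfolding P_def using n by (intro map_pmf_of_set_bij_betw) auto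
  have step: "T ((T ^^ i) p) = (T ^^ s i) p" if "i < n" for i
  proof (cases "i + 1 = n")
    case True
    then have "T ((T ^^ i) p) = (T ^^ n) p" by auto
    then show ?thesis using True p by (simp add: s_def)
  qed (use that in \<open>simp add: s_def\<close>)
  have "distr M borel T = distr (measure_pmf P) borel (\<lambda>i. T ((T ^^ i) p))"
    unfolding M_def by (subst distr_distr) (auto simp: measurable_T comp_def)
  also have "\<dots> = distr (measure_pmf P) borel (\<lambda>i. (T ^^ s i) p)"
    by (intro distr_cong_AE) (auto simp: AE_measure_pmf_iff set_P step)
  also have "\<dots> = distr (distr (measure_pmf P) (count_space UNIV) s) borel (\<lambda>i. (T ^^ i) p)"
    by (subst distr_distr) (auto simp: comp_def)
  also have "distr (measure_pmf P) (count_space UNIV) s = measure_pmf (map_pmf s P)"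
    by (simp add: map_pmf_rep_eq)
  finally have inv: "distr M borel T = M" by (simp add: shift M_def)
  have "prob_space M" unfolding M_def by (intro prob_space.prob_space_distr) (auto simp: measure_pmf.prob_space_axioms)
  then have "M \<in> invariant_probs T" using inv by (simp add: invariant_probs_def M_def)
  moreover have "(\<integral>x. f x \<partial>M) = S f n p / real n" if f: "continuous_on UNIV f" for f :: "'a \<Rightarrow> real"
  proof -
    have "(\<integral>x. f x \<partial>M) = (\<integral>i. f ((T ^^ i) p) \<partial>measure_pmf P)"
      unfolding M_def using f by (intro integral_distr borel_measurable_continuous_onI) auto
    also have "\<dots> = S f n p / real n"
      unfolding P_def using n
      by (subst integral_pmf_of_set) (auto simp: birkhoff_sum_def lessThan_empty_iff)
    finally show ?thesis .
  qed
  ultimately show ?thesis by (rule that)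
qed

lemma finite_net:
  assumes "0 < e"
  obtains D :: "'a set" where "finite D" "\<And>x. \<exists>p\<in>D. dist p x < e"
proof -
  obtain D where "finite D" and cov: "(UNIV :: 'a set) \<subseteq> (\<Union>p\<in>D. ball p e)"
    using seq_compact_imp_totally_bounded[OF compact_imp_seq_compact[OF compact_space]] assms
    by blast
  have "\<exists>p\<in>D. dist p x < e" for x
  proof -
    have "x \<in> (\<Union>p\<in>D. ball p e)" using cov by blast
    then show ?thesis by auto
  qed
  with \<open>finite D\<close> show ?thesis by (rule that)
qed

lemma finite_preimages: "finite (T -` {x})"
proof -
  have "0 < \<eta>" using \<xi>_pos \<xi>_le by simp
  then obtain D :: "'a set" where D: "finite D" "\<And>x. \<exists>p\<in>D. dist p x < \<eta>" using finite_net by blast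
  then obtain c where c: "\<And>y. c y \<in> D" "\<And>y. dist (c y) y < \<eta>" by metis
  have "inj_on c (T -` {x})"
  proof (rule inj_onI)
    fix y z assume yz: "y \<in> T -` {x}" "z \<in> T -` {x}" "c y = c z"
    have "dist y z \<le> 2 * \<eta>" using dist_triangle3[of y z "c y"] c(2)[of y] c(2)[of z] yz(3) by simp
    then have "l * dist y z \<le> 0" using expand[of y z] yz by simp
    then show "y = z" using l_gt_1 by (simp add: mult_le_0_iff)
  qed
  moreover have "finite (c ` (T -` {x}))" using c(1) by (intro finite_subset[OF _ D(1)]) auto
  ultimately show ?thesis using finite_imageD by blast
qed

text \<open>Two points of any orbit are close to the same point of a finite net; the segment between them closes up
  to a periodic orbit.\<close>

lemma invariant_probs_nonempty: "invariant_probs T \<noteq> {}"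
proof -
  define r where "r = \<xi> / 2 * (1 - 1 / l)"
  have "r > 0" using l_gt_1 \<xi>_pos by (simp add: r_def)
  then obtain D :: "'a set" where D: "finite D" "\<And>x. \<exists>p\<in>D. dist p x < r / 2"
    using finite_net[of "r / 2"] by auto
  fix x :: 'a
  have "\<forall>i. \<exists>p. p \<in> D \<and> dist p ((T ^^ i) x) < r / 2" using D(2) by blast
  then obtain c where c: "\<And>i::nat. c i \<in> D" "\<And>i. dist (c i) ((T ^^ i) x) < r / 2"
    by metis
  have "\<not> inj c" using D(1) c(1) by (meson finite_subset image_subsetI infinite_UNIV_nat finite_imageD)
  then obtain i j where "i < j" "c i = c j" by (metis injI linorder_neqE_nat)
  have "dist ((T ^^ (j - i)) ((T ^^ i) x)) ((T ^^ i) x) \<le> r"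
  proof -
    have "(T ^^ (j - i)) ((T ^^ i) x) = (T ^^ j) x"
      using \<open>i < j\<close> by (metis comp_apply funpow_add le_add_diff_inverse2 less_imp_le)
    then show ?thesis
      using c(2)[of i] c(2)[of j] \<open>c i = c j\<close> dist_triangle2[of "(T ^^ j) x" "(T ^^ i) x" "c i"]
      by (simp add: dist_commute)
  qed
  then obtain p where "(T ^^ (j - i)) p = p"
    using closing[of "j - i" "(T ^^ i) x"] \<open>i < j\<close> unfolding r_def by auto
  then show ?thesis using periodic_orbit_measure[of "j - i" p] \<open>i < j\<close> by (metis empty_iff zero_less_diff)
qed

lemma invariant_integral_le:
  fixes f :: "'a \<Rightarrow> real"
  assumes M: "M \<in> invariant_probs T" and "continuous_on UNIV f" and "\<And>x. f x \<le> c"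
  shows "(\<integral>x. f x \<partial>M) \<le> c"
proof -
  interpret prob_space M using M by (simp add: invariant_probs_def)
  have "(\<integral>x. f x \<partial>M) \<le> (\<integral>x. c \<partial>M)"
    using assms by (intro Bochner_Integration.integral_mono invariant_integrable) auto
  then show ?thesis by (simp add: prob_space)
qed

lemma integral_le_Q:
  assumes "M \<in> invariant_probs T" and f: "continuous_on UNIV f"
  shows "(\<integral>x. f x \<partial>M) \<le> Q T f"
proof -
  obtain K where K: "\<And>x. \<bar>f x\<bar> \<le> K" using bounded_continuous[OF f] by blast
  have "bdd_above ((\<lambda>M. \<integral>x. f x \<partial>M) ` invariant_probs T)"
    by (rule bdd_aboveI[where M = K])
       (use K f invariant_integral_le abs_le_D1 in blast)
  then show ?thesis unfolding Q_def using assms(1) by (intro cSUP_upper)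
qed

text \<open>The integral of a Birkhoff sum is \<open>n\<close> times the integral of the function.\<close>

lemma Q_le_birkhoff_bound:
  assumes f: "continuous_on UNIV f" and le: "\<And>x. S f n x \<le> c"
  shows "real n * Q T f \<le> c"
proof (cases "n = 0")
  case True
  then show ?thesis using le[of undefined] by simp
next
  case False
  have "Q T f \<le> c / real n" unfolding Q_def
  proof (rule cSUP_least[OF invariant_probs_nonempty])
    fix M assume M: "M \<in> invariant_probs T"
    have "real n * (\<integral>x. f x \<partial>M) \<le> c"
      using invariant_integral_le[OF M continuous_birkhoff[OF f] le] invariant_integral_birkhoff[OF M f]
      by simp
    then show "(\<integral>x. f x \<partial>M) \<le> c / real n" using False by (simp add: field_simps)
  qed
  then show ?thesis using False by (simp add: field_simps)
qed

lemma Q_le_Q_add: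
  assumes f: "continuous_on UNIV f" "continuous_on UNIV g" and le: "\<And>x. f x \<le> g x + c"
  shows "Q T f \<le> Q T g + c"
  unfolding Q_def[of T f]
proof (rule cSUP_least[OF invariant_probs_nonempty])
  fix M assume M: "M \<in> invariant_probs T"
  have "(\<integral>x. f x - g x \<partial>M) \<le> c"
    by (rule invariant_integral_le[OF M]) (use f le in \<open>auto intro!: continuous_intros simp: algebra_simps\<close>)
  moreover have "(\<integral>x. f x - g x \<partial>M) = (\<integral>x. f x \<partial>M) - (\<integral>x. g x \<partial>M)"
    using f by (intro Bochner_Integration.integral_diff invariant_integrable[OF M])
  ultimately show "(\<integral>x. f x \<partial>M) \<le> Q T g + c" using integral_le_Q[OF M f(2)] by linarith
qed

text \<open>A periodic orbit has nonpositive Birkhoff sum for the normalised potential, hence so has,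
  up to the distortion constant, every segment that nearly returns to its starting point.  An
  arbitrary segment decomposes into a bounded number of such pieces: cover the space by finitely many small
  balls, cut at the last visit to the ball containing the starting point, and that ball is
  never visited again.\<close>

lemma birkhoff_upper_bound:
  assumes A: "A \<in> holder_space \<alpha>"
  obtains K where "0 \<le> K" "\<And>n x. S (\<lambda>x. A x - Q T A) n x \<le> K"
proof -
  define B where "B = (\<lambda>x. A x - Q T A)"
  have cA: "continuous_on UNIV A" using A \<alpha>_pos by (rule holder_continuous)
  have "B \<in> holder_space \<alpha>" unfolding B_def by (intro holder_space_diff A holder_space_const)
  then obtain C where C: "0 \<le> C" "\<And>x y. \<bar>B x - B y\<bar> \<le> C * dist x y powr \<alpha>"
    by (rule holder_spaceE) blast
  have cB: "continuous_on UNIV B" unfolding B_def by (intro continuous_intros cA)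
  obtain b where b: "0 \<le> b" "\<And>x. \<bar>B x\<bar> \<le> b" using bounded_continuous[OF cB] by blast
  define K1 where "K1 = C * distortion * (\<xi> / 2) powr \<alpha>"
  define r where "r = \<xi> / 2 * (1 - 1 / l)"
  have r: "r > 0" using l_gt_1 \<xi>_pos by (simp add: r_def)
  have K1: "0 \<le> K1" using C(1) distortion_pos by (simp add: K1_def)
  have periodic: "S B n p \<le> 0" if per: "(T ^^ n) p = p" for n p
  proof (cases "n = 0")
    case False
    then obtain M where M: "M \<in> invariant_probs T"
      and int: "\<And>f::'a \<Rightarrow> real. continuous_on UNIV f \<Longrightarrow> (\<integral>x. f x \<partial>M) = S f n p / real n"
      using periodic_orbit_measure[OF _ per] by blast
    then have "S A n p / real n \<le> Q T A" using integral_le_Q[OF M cA] int[OF cA] by simp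
    then show ?thesis using False by (simp add: B_def birkhoff_diff_const field_simps)
  qed simp
  have return: "S B n x \<le> K1" if ret: "dist ((T ^^ n) x) x \<le> r" for n x
  proof (cases "n = 0")
    case False
    obtain p where p: "(T ^^ n) p = p"
      "\<And>i. i \<le> n \<Longrightarrow> l ^ (n - i) * dist ((T ^^ i) x) ((T ^^ i) p) \<le> \<xi> / 2"
      using closing[OF _ ret[unfolded r_def]] False by (metis neq0_conv)
    show ?thesis
      using birkhoff_distortion[OF C p(2)] periodic[OF p(1)] unfolding K1_def by fastforce
  qed (use K1 in simp)
  have pieces: "S B n x \<le> real (card D) * (K1 + b)"
    if "finite D" "\<And>i. i < n \<Longrightarrow> \<exists>p\<in>D. dist p ((T ^^ i) x) < r / 2" for D n x
    using that
  proof (induction "card D" arbitrary: D n x)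
    case 0
    then have "n = 0" by (metis bot_nat_0.not_eq_extremum card_0_eq empty_iff)
    then show ?case by (simp add: K1 b(1))
  next
    case (Suc k)
    show ?case
    proof (cases "n = 0")
      case False
      then obtain p where p: "p \<in> D" "dist p x < r / 2" using Suc.prems(2)[of 0] by auto
      define J where "J = {i. i < n \<and> dist p ((T ^^ i) x) < r / 2}"
      have J: "finite J" "0 \<in> J" using False p by (auto simp: J_def)
      define j where "j = Max J"
      have j: "j \<in> J" "\<And>i. i \<in> J \<Longrightarrow> i \<le> j" using J unfolding j_def by (auto intro: Max_in)
      define m where "m = n - Suc j"
      have n: "n = Suc j + m" using j(1) by (simp add: m_def J_def)
      let ?y = "(T ^^ Suc j) x"
      have it: "(T ^^ i) ?y = (T ^^ (Suc j + i)) x" for i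
        by (metis add.commute comp_apply funpow_add)
      have "dist ((T ^^ j) x) x \<le> r"
        using j(1) p(2) dist_triangle3[of "(T ^^ j) x" x p] by (simp add: J_def)
      then have 1: "S B (Suc j) x \<le> K1 + b"
        using return[of j x] b(2)[of "(T ^^ j) x"] by (simp add: birkhoff_Suc)
      have "S B m ?y \<le> real (card (D - {p})) * (K1 + b)"
      proof (rule Suc.hyps(1))
        show "k = card (D - {p})" using Suc.hyps(2) Suc.prems(1) p(1) by simp
        fix i assume "i < m"
        then have "Suc j + i < n" by (simp add: m_def)
        moreover from this have "Suc j + i \<notin> J" using j(2)[of "Suc j + i"] by auto
        ultimately show "\<exists>q\<in>D - {p}. dist q ((T ^^ i) ?y) < r / 2"
          unfolding it using Suc.prems(2)[of "Suc j + i"] by (auto simp: J_def)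
      qed (use Suc.prems in auto)
      moreover have "card D = Suc (card (D - {p}))"
        using Suc.prems(1) p(1) by (rule card.remove)
      ultimately show ?thesis
        using 1 unfolding n birkhoff_add_time by (simp add: algebra_simps)
    qed (simp add: K1 b(1))
  qed
  obtain D :: "'a set" where D: "finite D" "\<And>x. \<exists>p\<in>D. dist p x < r / 2"
    using finite_net[of "r / 2"] r by auto
  show ?thesis
  proof (rule that)
    show "0 \<le> real (card D) * (K1 + b)" using K1 b(1) by simp
    show "S (\<lambda>x. A x - Q T A) n x \<le> real (card D) * (K1 + b)" for n x
      using pieces[OF D(1), of n x] D(2) unfolding B_def by blast
  qed
qed

text \<open>Otherwise the maximum of the continuous function \<open>S A n\<close> would bound \<open>n\<close> times the integral of \<open>A\<close> by less than \<open>n Q\<close>.\<close>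

lemma birkhoff_nonneg_somewhere:
  assumes A: "A \<in> holder_space \<alpha>"
  shows "\<exists>x. 0 \<le> S (\<lambda>x. A x - Q T A) n x"
proof -
  have cA: "continuous_on UNIV A" using A \<alpha>_pos by (rule holder_continuous)
  obtain x where x: "\<And>y. S A n y \<le> S A n x"
    using continuous_attains_sup[OF compact_space _ continuous_birkhoff[OF cA, of n]] by auto
  have "real n * Q T A \<le> S A n x" by (rule Q_le_birkhoff_bound[OF cA x])
  then show ?thesis by (auto simp: birkhoff_diff_const)
qed

end

section \<open>Sub-actions and limits of iterates\<close>

locale holder_potential = open_expanding_map +
  fixes A :: "'a \<Rightarrow> real"
  assumes A_holder: "A \<in> holder_space \<alpha>"
begin

definition B :: "'a \<Rightarrow> real" where
  "B = (\<lambda>x. A x - Q T A)"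

lemma B_holder: "B \<in> holder_space \<alpha>"
  unfolding B_def by (intro holder_space_diff A_holder holder_space_const)

lemma cont_A: "continuous_on UNIV A"
  using A_holder \<alpha>_pos by (rule holder_continuous)

lemma cont_B: "continuous_on UNIV B"
  using B_holder \<alpha>_pos by (rule holder_continuous)

lemma S_B: "S B n x = S A n x - real n * Q T A"
  by (simp add: B_def birkhoff_diff_const)

lemma S_B_bound:  "\<exists>K. \<forall>n x. S B n x \<le> K"
  unfolding B_def by (rule birkhoff_upper_bound[OF A_holder]) blast

lemma S_B_nonneg_somewhere: "\<exists>x. 0 \<le> S B n x"
  using birkhoff_nonneg_somewhere[OF A_holder] unfolding B_def by blast

text \<open>Backward orbits can be moved from \<open>x\<close> to a nearby \<open>x'\<close> at a cost that is uniform in their length.  All regularity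
  statements below come from this.\<close>

lemma preimage_transfer:
  assumes u: "u \<in> holder_space \<alpha>"
  obtains C where "0 \<le> C"
    "\<And>n x x' y. dist x x' < \<xi> \<Longrightarrow> (T ^^ n) y = x \<Longrightarrow>
       \<exists>y'. (T ^^ n) y' = x' \<and> dist y y' \<le> dist x x' \<and>
         \<bar>(u y + S B n y) - (u y' + S B n y')\<bar> \<le> C * dist x x' powr \<alpha>"
proof -
  obtain C1 where C1: "0 \<le> C1" "\<And>x y. \<bar>u x - u y\<bar> \<le> C1 * dist x y powr \<alpha>"
    using holder_spaceE[OF u] by blast
  obtain C2 where C2: "0 \<le> C2" "\<And>x y. \<bar>B x - B y\<bar> \<le> C2 * dist x y powr \<alpha>"
    using holder_spaceE[OF B_holder] by blast
  show ?thesis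
  proof (rule that)
    show "0 \<le> C1 + C2 * distortion" using C1(1) C2(1) distortion_pos by simp
    fix n x x' y assume d: "dist x x' < \<xi>" and y: "(T ^^ n) y = x"
    obtain y' where y': "(T ^^ n) y' = x'"
      "\<And>i. i \<le> n \<Longrightarrow> l ^ (n - i) * dist ((T ^^ i) y) ((T ^^ i) y') \<le> dist x x'"
      using pullback[of n y x'] d y by blast
    have "1 * dist y y' \<le> l ^ n * dist y y'"
      using l_gt_1 by (intro mult_right_mono one_le_power) auto
    then have near: "dist y y' \<le> dist x x'" using y'(2)[of 0] by simp
    then have "dist y y' powr \<alpha> \<le> dist x x' powr \<alpha>" using \<alpha>_pos by (intro powr_mono2) auto
    then have "C1 * dist y y' powr \<alpha> \<le> C1 * dist x x' powr \<alpha>" using C1(1) by (rule mult_left_mono)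
    then have "\<bar>(u y + S B n y) - (u y' + S B n y')\<bar> \<le> (C1 + C2 * distortion) * dist x x' powr \<alpha>"
      using C1(2)[of y y'] birkhoff_distortion[OF C2 y'(2)] by (simp add: distrib_right)
    with y'(1) near show "\<exists>y'. (T ^^ n) y' = x' \<and> dist y y' \<le> dist x x' \<and>
         \<bar>(u y + S B n y) - (u y' + S B n y')\<bar> \<le> (C1 + C2 * distortion) * dist x x' powr \<alpha>"
      by blast
  qed
qed

text \<open>The witness at \<open>x\<close> is the supremum of the Birkhoff sums along finite backward orbits of \<open>x\<close>, the empty
  one included; it is finite even if the limits of iterates below are not.\<close>

lemma subaction_exists:
  obtains v where "v \<in> holder_space \<alpha>" "\<And>x. B x + v x \<le> v (T x)"
proof -
  obtain K where K: "\<And>n x. S B n x \<le> K" using S_B_bound by blast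
  define W where "W x = {S B n y | n y. (T ^^ n) y = x}" for x
  define v where "v x = Sup (W x)" for x
  have bdd: "bdd_above (W x)" for x unfolding W_def by (rule bdd_aboveI[of _ K]) (use K in auto)
  have zero: "0 \<in> W x" for x
    unfolding W_def by (rule CollectI, rule exI[of _ 0], rule exI[of _ x]) simp
  have ne: "W x \<noteq> {}" for x using zero by blast
  have up: "S B n y \<le> v ((T ^^ n) y)" for n y
    unfolding v_def by (rule cSup_upper[OF _ bdd]) (auto simp: W_def)
  have bound: "\<bar>v x\<bar> \<le> K" for x
  proof -
    have "v x \<le> K" unfolding v_def by (rule cSup_least[OF ne]) (use K in \<open>auto simp: W_def\<close>)
    moreover have "0 \<le> v x" unfolding v_def by (rule cSup_upper[OF zero bdd])
    ultimately show ?thesis by simp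
  qed
  obtain C where C: "0 \<le> C" "\<And>n x x' y. dist x x' < \<xi> \<Longrightarrow> (T ^^ n) y = x \<Longrightarrow>
       \<exists>y'. (T ^^ n) y' = x' \<and> dist y y' \<le> dist x x' \<and>
         \<bar>(0 + S B n y) - (0 + S B n y')\<bar> \<le> C * dist x x' powr \<alpha>"
    using preimage_transfer[OF holder_space_const[of 0]] by blast
  have one_sided: "v x \<le> v x' + C * dist x x' powr \<alpha>" if d: "dist x x' < \<xi>" for x x'
    unfolding v_def[of x]
  proof (rule cSup_least[OF ne])
    fix s assume "s \<in> W x"
    then obtain n y where s: "s = S B n y" "(T ^^ n) y = x" by (auto simp: W_def)
    then obtain y' where "(T ^^ n) y' = x'" "\<bar>S B n y - S B n y'\<bar> \<le> C * dist x x' powr \<alpha>"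
      using C(2)[OF d s(2)] by auto
    then show "s \<le> v x' + C * dist x x' powr \<alpha>" using up[of n y'] s(1) by force
  qed
  have "\<bar>v x - v x'\<bar> \<le> C * dist x x' powr \<alpha>" if "dist x x' < \<xi>" for x x'
    using one_sided[OF that] one_sided[of x' x] that by (simp add: dist_commute abs_le_iff)
  then have "v \<in> holder_space \<alpha>"
    using bound \<xi>_pos \<alpha>_pos by (intro holder_space_local)
  moreover have "B x + v x \<le> v (T x)" for x
  proof -
    have "v x \<le> v (T x) - B x" unfolding v_def[of x]
    proof (rule cSup_least[OF ne])
      fix s assume "s \<in> W x"
      then obtain n y where s: "s = S B n y" "(T ^^ n) y = x" by (auto simp: W_def)
      then show "s \<le> v (T x) - B x" using up[of "Suc n" y] by (simp add: birkhoff_Suc)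
    qed
    then show ?thesis by simp
  qed
  ultimately show ?thesis by (rule that)
qed

text \<open>If no orbit were entirely contact, some Birkhoff sum of the nonpositive
  \<open>B + v - v \<circ> T\<close> would be negative throughout the compact space, so the Birkhoff sums of \<open>B\<close> would
  tend to \<open>-\<infinity>\<close> uniformly.\<close>

lemma contact_orbit:
  assumes v: "v \<in> holder_space \<alpha>" and sub: "\<And>x. B x + v x \<le> v (T x)"
  obtains z where "\<And>n. S B n z = v ((T ^^ n) z) - v z"
proof -
  define G where "G x = B x + v x - v (T x)" for x
  have cv: "continuous_on UNIV v" using v \<alpha>_pos by (rule holder_continuous)
  have cG: "continuous_on UNIV G" unfolding G_def
    by (intro continuous_intros cont_B cv continuous_on_compose2[OF cv cont_T]) auto
  have G0: "G x \<le> 0" for x using sub[of x] by (simp add: G_def)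
  have SG: "S G n x = S B n x + v x - v ((T ^^ n) x)" for n x
    unfolding G_def by (rule birkhoff_coboundary)
  obtain V where V: "\<And>x. \<bar>v x\<bar> \<le> V" using bounded_continuous[OF cv] by blast
  have "\<exists>z. \<forall>k. G ((T ^^ k) z) = 0"
  proof (rule ccontr)
    assume "\<not> ?thesis"
    then have neg: "\<exists>k. G ((T ^^ k) x) < 0" for x using G0 by (metis order_le_less)
    let ?U = "\<lambda>k. {x. G ((T ^^ k) x) < 0}"
    have op: "open (?U k)" for k
      using cG continuous_iterate
      by (intro open_Collect_less continuous_on_const continuous_on_compose2[OF cG]) auto
    have cov: "UNIV \<subseteq> (\<Union>k\<in>UNIV. ?U k)" using neg by blast
    obtain F where F: "F \<subseteq> UNIV" "finite F" "UNIV \<subseteq> (\<Union>k\<in>F. ?U k)"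
      by (rule compactE_image[OF compact_space op cov])
    define N where "N = Suc (Max F)"
    have strict: "S G N x < 0" for x
    proof -
      have "x \<in> (\<Union>k\<in>F. ?U k)" using F(3) by blast
      then obtain k where k: "k \<in> F" "G ((T ^^ k) x) < 0" by blast
      then have "k \<in> {..<N}" using F(2) by (auto simp: N_def less_Suc_eq_le)
      moreover have "\<forall>i\<in>{..<N}. G ((T ^^ i) x) \<le> 0" using G0 by blast
      ultimately have "(\<Sum>i<N. G ((T ^^ i) x)) < (\<Sum>i<N. 0)"
        using k(2) by (intro sum_strict_mono_ex1) auto
      then show ?thesis by (simp add: birkhoff_sum_def)
    qed
    obtain x0 where x0: "\<And>x. S G N x \<le> S G N x0"
      using continuous_attains_sup[OF compact_space _ continuous_birkhoff[OF cG, of N]] by auto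
    define \<delta> where "\<delta> = - S G N x0"
    have \<delta>: "\<delta> > 0" "\<And>x. S G N x \<le> - \<delta>" using strict x0 by (auto simp: \<delta>_def)
    have drop: "S G (q * N) x \<le> - (real q * \<delta>)" for q x
    proof (induction q arbitrary: x)
      case (Suc q)
      show ?case
        using Suc[of "(T ^^ N) x"] \<delta>(2)[of x] by (simp add: birkhoff_add_time algebra_simps)
    qed simp
    obtain q :: nat where q: "2 * V < real q * \<delta>" using reals_Archimedean3[OF \<delta>(1)] by blast
    obtain x where "0 \<le> S B (q * N) x" using S_B_nonneg_somewhere by blast
    then show False
      using drop[of q x] q V[of x] V[of "(T ^^ (q * N)) x"] unfolding SG by linarith
  qed
  then obtain z where z: "\<And>k. G ((T ^^ k) z) = 0" by blast
  have "S B n z = v ((T ^^ n) z) - v z" for n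
    using SG[of n z] by (simp add: birkhoff_sum_def z)
  then show ?thesis by (rule that)
qed

text \<open>The finite time optimum, with value \<open>-\<infinity>\<close> at points without preimages of order \<open>n\<close>.\<close>

definition V_n :: "('a \<Rightarrow> real) \<Rightarrow> nat \<Rightarrow> 'a \<Rightarrow> ereal" where
  "V_n u n x = (SUP y\<in>{y. (T ^^ n) y = x}. ereal (u y + S B n y))"

lemma limsup_iterates_eq: "limsup_iterates T A u x = limsup (\<lambda>n. V_n u n x)"
  unfolding limsup_iterates_def V_n_def bousch_iterate B_def ..

lemma V_n_ge: "ereal (u y + S B n y) \<le> V_n u n ((T ^^ n) y)"
  unfolding V_n_def by (rule SUP_upper) simp

lemma V_n_le: "(\<And>y. (T ^^ n) y = x \<Longrightarrow> ereal (u y + S B n y) \<le> c) \<Longrightarrow> V_n u n x \<le> c"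
  unfolding V_n_def by (rule SUP_least) simp

lemma V_n_local:
  assumes u: "u \<in> holder_space \<alpha>"
  obtains C where "0 \<le> C"
    "\<And>n x x'. dist x x' < \<xi> \<Longrightarrow> V_n u n x \<le> V_n u n x' + ereal (C * dist x x' powr \<alpha>)"
proof -
  obtain C where C: "0 \<le> C" "\<And>n x x' y. dist x x' < \<xi> \<Longrightarrow> (T ^^ n) y = x \<Longrightarrow>
       \<exists>y'. (T ^^ n) y' = x' \<and> dist y y' \<le> dist x x' \<and>
         \<bar>(u y + S B n y) - (u y' + S B n y')\<bar> \<le> C * dist x x' powr \<alpha>"
    using preimage_transfer[OF u] by blast
  show ?thesis
  proof (rule that[OF C(1)])
    fix n and x x' :: 'a assume d: "dist x x' < \<xi>"
    show "V_n u n x \<le> V_n u n x' + ereal (C * dist x x' powr \<alpha>)"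
    proof (rule V_n_le)
      fix y assume "(T ^^ n) y = x"
      then obtain y' where y': "(T ^^ n) y' = x'"
        "\<bar>(u y + S B n y) - (u y' + S B n y')\<bar> \<le> C * dist x x' powr \<alpha>"
        using C(2)[OF d] by blast
      have "ereal (u y + S B n y) \<le> ereal (u y' + S B n y') + ereal (C * dist x x' powr \<alpha>)"
        using y'(2) by simp
      also have "\<dots> \<le> V_n u n x' + ereal (C * dist x x' powr \<alpha>)"
        using V_n_ge[of u y' n] y'(1) by (intro add_right_mono) simp
      finally show "ereal (u y + S B n y) \<le> V_n u n x' + ereal (C * dist x x' powr \<alpha>)" .
    qed
  qed
qed

abbreviation V :: "('a \<Rightarrow> real) \<Rightarrow> 'a \<Rightarrow> ereal" where
  "V \<equiv> limsup_iterates T A"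

lemma V_local:
  assumes u: "u \<in> holder_space \<alpha>"
  obtains C where "0 \<le> C"
    "\<And>x x'. dist x x' < \<xi> \<Longrightarrow> V u x \<le> V u x' + ereal (C * dist x x' powr \<alpha>)"
proof -
  obtain C where C: "0 \<le> C"
    "\<And>n x x'. dist x x' < \<xi> \<Longrightarrow> V_n u n x \<le> V_n u n x' + ereal (C * dist x x' powr \<alpha>)"
    using V_n_local[OF u] by blast
  show ?thesis
  proof (rule that[OF C(1)])
    fix x x' :: 'a assume d: "dist x x' < \<xi>"
    have "V u x \<le> limsup (\<lambda>n. V_n u n x' + ereal (C * dist x x' powr \<alpha>))"
      unfolding limsup_iterates_eq using C(2)[OF d] by (intro Limsup_mono always_eventually) auto
    then show "V u x \<le> V u x' + ereal (C * dist x x' powr \<alpha>)"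
      unfolding limsup_iterates_eq by (simp add: Limsup_add_ereal_right)
  qed
qed

lemma V_less_infinity:
  assumes "u \<in> holder_space \<alpha>" shows "V u x < \<infinity>"
proof -
  obtain K where K: "\<And>n x. S B n x \<le> K" using S_B_bound by blast
  obtain b where b: "\<And>x. \<bar>u x\<bar> \<le> b"
    using bounded_continuous[OF holder_continuous[OF assms \<alpha>_pos]] by blast
  have "u y + S B n y \<le> b + K" for n y using K[of n y] b[of y] by linarith
  then have "V_n u n x \<le> ereal (b + K)" for n by (intro V_n_le) simp
  then have "V u x \<le> ereal (b + K)"
    unfolding limsup_iterates_eq by (intro Limsup_bounded always_eventually) auto
  then show ?thesis by (metis ereal_infty_less_eq(1) less_ereal.simps(4) linorder_not_le neq_iff
        not_le order_le_less_trans)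
qed

lemma V_continuous:
  assumes u: "u \<in> holder_space \<alpha>"
  shows "continuous_on UNIV (V u)"
proof -
  obtain C where C: "0 \<le> C"
    "\<And>x x'. dist x x' < \<xi> \<Longrightarrow> V u x \<le> V u x' + ereal (C * dist x x' powr \<alpha>)"
    using V_local[OF u] by blast
  have "(V u \<longlongrightarrow> V u x) (at x)" for x
  proof -
    let ?e = "\<lambda>y. C * dist x y powr \<alpha>"
    have "(?e \<longlongrightarrow> C * dist x x powr \<alpha>) (at x)" using \<alpha>_pos by (intro tendsto_intros) auto
    then have e: "(?e \<longlongrightarrow> 0) (at x)" using \<alpha>_pos by simp
    have shift: "((\<lambda>y. V u x + ereal (h y)) \<longlongrightarrow> V u x) (at x)" if h: "(h \<longlongrightarrow> 0) (at x)" for h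
    proof (cases "V u x")
      case (real r)
      have "((\<lambda>y. ereal (r + h y)) \<longlongrightarrow> ereal (r + 0)) (at x)" by (intro tendsto_intros h)
      then show ?thesis by (simp add: real)
    qed (use V_less_infinity[OF u, of x] in simp_all)
    have upper: "((\<lambda>y. V u x + ereal (?e y)) \<longlongrightarrow> V u x) (at x)" by (rule shift[OF e])
    have lower: "((\<lambda>y. V u x + ereal (- ?e y)) \<longlongrightarrow> V u x) (at x)"
      by (rule shift) (use tendsto_minus[OF e] in simp)
    have near: "\<forall>\<^sub>F y in at x. dist x y < \<xi>"
      using \<xi>_pos by (auto simp: eventually_at dist_commute intro!: exI[of _ \<xi>])
    have ge: "\<forall>\<^sub>F y in at x. V u x + ereal (- ?e y) \<le> V u y"
      using near
    proof eventually_elim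
      case (elim y)
      have "V u x - ereal (?e y) \<le> V u y" using C(2)[OF elim] by (simp add: ereal_minus_le)
      then show ?case by (simp add: minus_ereal_def)
    qed
    have le: "\<forall>\<^sub>F y in at x. V u y \<le> V u x + ereal (?e y)"
      using near
    proof eventually_elim
      case (elim y)
      then show ?case using C(2)[of y x] by (simp add: dist_commute)
    qed
    show ?thesis by (rule tendsto_sandwich[OF ge le lower upper])
  qed
  then show ?thesis by (simp add: continuous_on_def)
qed

lemma V_in_cont_into:
  assumes "u \<in> holder_space \<alpha>"
  shows "V u \<in> cont_into (range ereal \<union> {-\<infinity>})"
proof -
  have "V u x \<in> range ereal \<union> {-\<infinity>}" for x
    using V_less_infinity[OF assms, of x] by (cases "V u x") auto
  then show ?thesis using V_continuous[OF assms] by (auto simp: cont_into_def)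
qed

lemma V_n_Suc: "V_n u (Suc n) x = (SUP y\<in>T -` {x}. V_n u n y + ereal (B y))"
  using bousch_iterate[of "Suc n" T B u x]
  by (simp add: V_n_def bousch_def bousch_iterate[of n] )

text \<open>A limsup commutes with the supremum over the preimages because there are finitely many.\<close>

lemma V_step: "V u x = (SUP y\<in>T -` {x}. V u y + ereal (B y))"
proof (rule antisym)
  have shift: "V u x = limsup (\<lambda>n. V_n u (Suc n) x)"
    unfolding limsup_iterates_eq using limsup_shift[of "\<lambda>n. V_n u n x"] by simp
  have one: "V u y + ereal (B y) = limsup (\<lambda>n. V_n u n y + ereal (B y))" for y
    unfolding limsup_iterates_eq by (simp add: Limsup_add_ereal_right)
  show "(SUP y\<in>T -` {x}. V u y + ereal (B y)) \<le> V u x"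
  proof (rule SUP_least)
    fix y assume y: "y \<in> T -` {x}"
    show "V u y + ereal (B y) \<le> V u x"
      unfolding one shift V_n_Suc
      by (intro Limsup_mono always_eventually allI SUP_upper y)
  qed
  show "V u x \<le> (SUP y\<in>T -` {x}. V u y + ereal (B y))"
    unfolding shift Limsup_le_iff
  proof (intro allI impI)
    fix c assume c: "(SUP y\<in>T -` {x}. V u y + ereal (B y)) < c"
    then obtain c' where c': "(SUP y\<in>T -` {x}. V u y + ereal (B y)) < c'" "c' < c"
      using dense by blast
    have "\<forall>\<^sub>F n in sequentially. V_n u n y + ereal (B y) < c'" if y: "y \<in> T -` {x}" for y
    proof (rule Limsup_lessD)
      have "V u y + ereal (B y) \<le> (SUP y\<in>T -` {x}. V u y + ereal (B y))" using y by (rule SUP_upper)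
      then show "limsup (\<lambda>n. V_n u n y + ereal (B y)) < c'" using c'(1) unfolding one by simp
    qed
    then have "\<forall>\<^sub>F n in sequentially. \<forall>y\<in>T -` {x}. V_n u n y + ereal (B y) < c'"
      by (intro eventually_ball_finite finite_preimages) auto
    then show "\<forall>\<^sub>F n in sequentially. V_n u (Suc n) x < c"
    proof eventually_elim
      case (elim n)
      have "V_n u (Suc n) x \<le> c'" unfolding V_n_Suc using elim by (intro SUP_least) (auto intro: less_imp_le)
      then show ?case using c'(2) by simp
    qed
  qed
qed

lemma V_bousch: "bousch T A (V u) = (\<lambda>x. V u x \<otimes>\<^sub>t ereal (Q T A))"
proof
  fix x
  have A: "ereal (A y) = ereal (B y) + ereal (Q T A)" for y by (simp add: B_def)
  have "(SUP y\<in>T -` {x}. V u y + ereal (A y)) = (SUP y\<in>T -` {x}. V u y + ereal (B y)) + ereal (Q T A)"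
    (is "?l = ?r")
  proof (rule antisym)
    show "?l \<le> ?r"
      unfolding A add.assoc[symmetric] by (intro SUP_least add_right_mono SUP_upper)
    have "(SUP y\<in>T -` {x}. V u y + ereal (B y)) \<le> ?l - ereal (Q T A)"
    proof (rule SUP_least)
      fix y assume "y \<in> T -` {x}"
      then have "V u y + ereal (A y) \<le> ?l" by (rule SUP_upper)
      then show "V u y + ereal (B y) \<le> ?l - ereal (Q T A)"
        by (simp add: ereal_le_minus A add.assoc)
    qed
    then show "?r \<le> ?l" by (simp add: ereal_le_minus)
  qed
  then show "bousch T A (V u) x = V u x \<otimes>\<^sub>t ereal (Q T A)"
    by (simp add: bousch_def V_step[of u x])
qed

text \<open>The choice of \<open>u\<close> affects \<open>V u\<close> by a bounded amount only.\<close>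

lemma V_finite_transfer:
  assumes u: "u \<in> holder_space \<alpha>" and fin: "V (\<lambda>_. 0) x \<noteq> -\<infinity>"
  shows "\<bar>V u x\<bar> \<noteq> \<infinity>"
proof -
  obtain b where b: "\<And>x. \<bar>u x\<bar> \<le> b"
    using bounded_continuous[OF holder_continuous[OF u \<alpha>_pos]] by blast
  have "V_n (\<lambda>_. 0) n x \<le> V_n u n x + ereal b" for n
  proof (rule V_n_le)
    fix y assume y: "(T ^^ n) y = x"
    have "ereal (0 + S B n y) \<le> ereal (u y + S B n y) + ereal b" using b[of y] by simp
    also have "\<dots> \<le> V_n u n x + ereal b" using V_n_ge[of u y n] y by (intro add_right_mono) simp
    finally show "ereal (0 + S B n y) \<le> V_n u n x + ereal b" .
  qed
  then have "V (\<lambda>_. 0) x \<le> limsup (\<lambda>n. V_n u n x + ereal b)"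
    unfolding limsup_iterates_eq by (intro Limsup_mono always_eventually) auto
  also have "\<dots> = V u x + ereal b" unfolding limsup_iterates_eq by (simp add: Limsup_add_ereal_right)
  finally show ?thesis using fin V_less_infinity[OF u, of x] by (cases "V u x") auto
qed

lemma V_holder:
  assumes u: "u \<in> holder_space \<alpha>" and fin: "\<And>x. V (\<lambda>_. 0) x \<noteq> -\<infinity>"
  obtains w where "w \<in> holder_space \<alpha>" "V u = (\<lambda>x. ereal (w x))"
proof -
  define w where "w x = real_of_ereal (V u x)" for x
  have V: "V u x = ereal (w x)" for x
    using V_finite_transfer[OF u fin, of x] by (simp add: w_def ereal_real')
  obtain C where C: "0 \<le> C"
    "\<And>x x'. dist x x' < \<xi> \<Longrightarrow> V u x \<le> V u x' + ereal (C * dist x x' powr \<alpha>)"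
    using V_local[OF u] by blast
  have loc: "\<bar>w x - w x'\<bar> \<le> C * dist x x' powr \<alpha>" if "dist x x' < \<xi>" for x x'
    using C(2)[OF that] C(2)[of x' x] that by (simp add: V dist_commute abs_le_iff)
  have "continuous_on UNIV w"
    using V_continuous[OF u] continuous_on_iff_real[of UNIV "V u"] by (simp add: V comp_def)
  then obtain K where "\<And>x. \<bar>w x\<bar> \<le> K" using bounded_continuous by blast
  then have "w \<in> holder_space \<alpha>" using loc \<xi>_pos \<alpha>_pos by (intro holder_space_local)
  then show ?thesis using V by (intro that) auto
qed

lemma V_eigenfunction:
  assumes "V u \<in> cont_into (range ereal)"
  shows "tropical_eigenfunction T A (V u)"
  using assms V_bousch unfolding tropical_eigenfunction_def eigenfunction_for_def by blast

text \<open>A contact orbit passes near one of its accumulation points at infinitely many times, with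
  Birkhoff sums bounded below; moving these segments so that they end at the accumulation point bounds \<open>V\<close>
  from below there.\<close>

lemma V_finite_somewhere: "\<exists>x. V (\<lambda>_. 0) x \<noteq> -\<infinity>"
proof -
  obtain v where v: "v \<in> holder_space \<alpha>" "\<And>x. B x + v x \<le> v (T x)" using subaction_exists by blast
  obtain z where z: "\<And>n. S B n z = v ((T ^^ n) z) - v z" using contact_orbit[OF v] by blast
  obtain b where b: "\<And>x. \<bar>v x\<bar> \<le> b"
    using bounded_continuous[OF holder_continuous[OF v(1) \<alpha>_pos]] by blast
  obtain C where C: "0 \<le> C" "\<And>n x x'. dist x x' < \<xi> \<Longrightarrow>
      V_n (\<lambda>_. 0) n x \<le> V_n (\<lambda>_. 0) n x' + ereal (C * dist x x' powr \<alpha>)"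
    using V_n_local[OF holder_space_const[of 0]] by blast
  obtain a r where r: "strict_mono r" "((\<lambda>n. (T ^^ n) z) \<circ> r) \<longlonglongrightarrow> a"
    using compact_space[unfolded compact_def] by (metis UNIV_I)
  let ?c = "ereal (- 2 * b - C * \<xi> powr \<alpha>)"
  have "\<forall>\<^sub>F j in sequentially. dist ((T ^^ r j) z) a < \<xi>"
    using r(2) \<xi>_pos by (simp add: tendsto_iff comp_def)
  then have "\<forall>\<^sub>F j in sequentially. ?c \<le> ((\<lambda>n. V_n (\<lambda>_. 0) n a) \<circ> r) j"
  proof eventually_elim
    case (elim j)
    have "dist ((T ^^ r j) z) a powr \<alpha> \<le> \<xi> powr \<alpha>"
      using elim \<alpha>_pos by (intro powr_mono2) auto
    then have "C * dist ((T ^^ r j) z) a powr \<alpha> \<le> C * \<xi> powr \<alpha>" using C(1) by (rule mult_left_mono)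
    moreover have "- 2 * b \<le> S B (r j) z"
      unfolding z using b[of z] b[of "(T ^^ r j) z"] by linarith
    ultimately have "?c \<le> ereal (S B (r j) z) - ereal (C * dist ((T ^^ r j) z) a powr \<alpha>)" by simp
    also have "\<dots> \<le> V_n (\<lambda>_. 0) (r j) ((T ^^ r j) z) - ereal (C * dist ((T ^^ r j) z) a powr \<alpha>)"
      using V_n_ge[of "\<lambda>_. 0" z "r j"] by (intro ereal_minus_mono) auto
    also have "\<dots> \<le> V_n (\<lambda>_. 0) (r j) a" using C(2)[OF elim] by (simp add: ereal_minus_le)
    finally show ?case by simp
  qed
  then have "?c \<le> limsup ((\<lambda>n. V_n (\<lambda>_. 0) n a) \<circ> r)" by (intro le_Limsup) auto
  also have "\<dots> \<le> V (\<lambda>_. 0) a" unfolding limsup_iterates_eq by (rule limsup_subseq_mono[OF r(1)])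
  finally show ?thesis by (intro exI[of _ a]) auto
qed

text \<open>The local modulus of continuity makes \<open>{V = -\<infinity>}\<close> open, and \<open>V (T y) \<ge> V y + B y\<close> makes its open complement
  forward invariant; transitivity leaves no room for both to be nonempty.\<close>

lemma V_finite_transitive:
  assumes "topologically_transitive T"
  shows "V (\<lambda>_. 0) x \<noteq> -\<infinity>"
proof
  assume x: "V (\<lambda>_. 0) x = -\<infinity>"
  let ?V = "V (\<lambda>_. 0)"
  have c: "continuous_on UNIV ?V" by (rule V_continuous[OF holder_space_const])
  obtain C where C: "0 \<le> C"
    "\<And>x x'. dist x x' < \<xi> \<Longrightarrow> ?V x \<le> ?V x' + ereal (C * dist x x' powr \<alpha>)"
    using V_local[OF holder_space_const[of 0]] by blast
  let ?W = "{y. ?V y \<noteq> -\<infinity>}" and ?N = "{y. ?V y = -\<infinity>}"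
  have "open ?N"
    unfolding open_dist
  proof safe
    fix y assume y: "?V y = -\<infinity>"
    have "z \<in> ?N" if "dist z y < \<xi>" for z using C(2)[OF that] y by simp
    then show "\<exists>e>0. \<forall>z. dist z y < e \<longrightarrow> z \<in> ?N" using \<xi>_pos by blast
  qed
  moreover have "open ?W"
    using c by (intro open_Collect_neq continuous_on_const)
  moreover have "?W \<noteq> {}" using V_finite_somewhere by blast
  moreover have "?N \<noteq> {}" using x by blast
  ultimately obtain n where n: "(T ^^ n) ` ?W \<inter> ?N \<noteq> {}"
    using assms unfolding topologically_transitive_def by blast
  have "?V ((T ^^ k) y) \<noteq> -\<infinity>" if "?V y \<noteq> -\<infinity>" for k y
  proof (induction k)
    case (Suc k)
    let ?y = "(T ^^ k) y"
    have "?V ?y + ereal (B ?y) \<le> ?V (T ?y)" by (subst (2) V_step) (rule SUP_upper, simp)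
    then show ?case using Suc by (cases "?V ?y") auto
  qed (use that in simp)
  then show False using n by blast
qed

end

section \<open>Eigenfunctions are calibrated sub-actions\<close>

lemma slope_nonpos:
  fixes a c :: real
  assumes "\<And>n::nat. real n * a \<le> c"
  shows "a \<le> 0"
proof (rule ccontr)
  assume "\<not> a \<le> 0"
  then obtain n :: nat where "c < real n * a" using reals_Archimedean3[of a] by auto
  then show False using assms[of n] by simp
qed

context holder_potential
begin

text \<open>Iterating the sub-action inequality gives \<open>Q \<le> \<kappa>\<close>; iterating the calibration, backward orbits with Birkhoff
  sums of \<open>A - \<kappa>\<close> bounded below, gives \<open>\<kappa> \<le> Q\<close>.\<close>

lemma eigenfunction_structure:
  assumes eig: "eigenfunction_for T A \<kappa> u"
  obtains w where "u = (\<lambda>x. ereal (w x))" "continuous_on UNIV w" "\<kappa> = ereal (Q T A)"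
    "\<And>y. B y + w y \<le> w (T y)" "\<And>x. \<exists>y. T y = x \<and> w x = B y + w y"
proof -
  have u: "continuous_on UNIV u" "range u \<subseteq> range ereal"
    and eq: "bousch T A u = (\<lambda>x. u x \<otimes>\<^sub>t \<kappa>)"
    using eig by (auto simp: eigenfunction_for_def cont_into_def)
  have "\<forall>x. \<exists>r. u x = ereal r" using u(2) by blast
  then obtain w where w: "\<And>x. u x = ereal (w x)" by metis
  have cw: "continuous_on UNIV w"
    using u(1) continuous_on_iff_real[of UNIV u] by (simp add: w comp_def)
  obtain W where W: "\<And>x. \<bar>w x\<bar> \<le> W" using bounded_continuous[OF cw] by blast
  obtain a where a: "\<And>x. \<bar>A x\<bar> \<le> a" using bounded_continuous[OF cont_A] by blast
  have sup: "(SUP y\<in>T -` {x}. ereal (w y + A y)) = ereal (w x) \<otimes>\<^sub>t \<kappa>" for x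
    using fun_cong[OF eq, of x] by (simp add: bousch_def w)
  have ge: "ereal (w y + A y) \<le> ereal (w (T y)) \<otimes>\<^sub>t \<kappa>" for y
    unfolding sup[symmetric] by (rule SUP_upper) simp
  have "\<kappa> \<noteq> -\<infinity>" using ge[of undefined] by (auto simp: tmult_def)
  moreover have "\<kappa> \<noteq> \<infinity>"
  proof
    assume k: "\<kappa> = \<infinity>"
    have "(SUP y\<in>T -` {undefined}. ereal (w y + A y)) \<le> ereal (W + a)"
      using W a by (intro SUP_least) (auto simp: abs_le_iff intro: add_mono)
    then show False unfolding sup k by (simp add: tmult_def)
  qed
  ultimately obtain k where k: "\<kappa> = ereal k" by (cases \<kappa>) auto
  have sub: "(A y - k) + w y \<le> w (T y)" for y using ge[of y] by (simp add: k)
  have cal: "\<exists>y. T y = x \<and> w x = (A y - k) + w y" for x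
  proof -
    let ?R = "(\<lambda>y. ereal (w y + A y)) ` (T -` {x})"
    have "?R \<noteq> {}"
    proof
      assume "?R = {}"
      then have "Sup ?R = -\<infinity>" by (simp add: bot_ereal_def)
      then show False using sup[of x] by (simp add: k)
    qed
    then have "Sup ?R \<in> ?R"
      using finite_preimages[of x] by (simp add: cSup_eq_Max Max_in)
    then obtain y where "T y = x" "Sup ?R = ereal (w y + A y)" by auto
    then show ?thesis using sup[of x] by (intro exI[of _ y]) (simp add: k)
  qed
  have "k = Q T A"
  proof (rule antisym)
    obtain K where K: "\<And>n x. S B n x \<le> K" using S_B_bound by blast
    have "real n * (k - Q T A) \<le> 2 * W + K" for n
    proof -
      obtain y where y: "w undefined = S (\<lambda>x. A x - k) n y + w y"
        using birkhoff_calibrated_preimage[of T w "\<lambda>x. A x - k", OF cal] by blast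
      then show ?thesis
        using K[of n y] W[of undefined] W[of y]
        by (simp add: S_B birkhoff_diff_const algebra_simps abs_le_iff)
    qed
    from slope_nonpos[OF this] show "k \<le> Q T A" by simp
    have "real n * (Q T A - k) \<le> 2 * W" for n
    proof -
      have "S A n y \<le> real n * k + 2 * W" for y
        using birkhoff_subaction_le[of "\<lambda>x. A x - k" w T n y, OF sub] W[of y] W[of "(T ^^ n) y"]
        by (simp add: birkhoff_diff_const abs_le_iff)
      then show ?thesis using Q_le_birkhoff_bound[OF cont_A] by (simp add: algebra_simps)
    qed
    from slope_nonpos[OF this] show "Q T A \<le> k" by simp
  qed
  then show ?thesis
    using that[of w] w cw k sub cal by (simp add: B_def fun_eq_iff)
qed

lemma eigenfunction_V_finite:
  assumes eig: "tropical_eigenfunction T A u"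
  shows "V (\<lambda>_. 0) x \<noteq> -\<infinity>"
proof -
  obtain \<kappa> where "eigenfunction_for T A \<kappa> u" using eig by (auto simp: tropical_eigenfunction_def)
  then obtain w where cw: "continuous_on UNIV w"
    and cal: "\<And>x. \<exists>y. T y = x \<and> w x = B y + w y"
    by (rule eigenfunction_structure) blast
  obtain W where W: "\<And>x. \<bar>w x\<bar> \<le> W" using bounded_continuous[OF cw] by blast
  have "ereal (- 2 * W) \<le> V_n (\<lambda>_. 0) n x" for n
  proof -
    obtain y where y: "(T ^^ n) y = x" "w x = S B n y + w y"
      using birkhoff_calibrated_preimage[of T w B, OF cal] by blast
    have "ereal (- 2 * W) \<le> ereal (0 + S B n y)" using y(2) W[of x] W[of y] by simp
    also have "\<dots> \<le> V_n (\<lambda>_. 0) n x" using V_n_ge[of "\<lambda>_. 0" y n] y(1) by simp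
    finally show ?thesis .
  qed
  then have "ereal (- 2 * W) \<le> V (\<lambda>_. 0) x"
    unfolding limsup_iterates_eq by (intro le_Limsup always_eventually) auto
  then show ?thesis by auto
qed

definition bounded_below_orbit :: "'a \<Rightarrow> bool" where
  "bounded_below_orbit y \<longleftrightarrow> (\<exists>C. \<forall>n. - C \<le> S B n y)"

text \<open>This replaces the uniqueness of the maximising measure: an orbit with Birkhoff sums of \<open>B\<close> bounded below
  has maximal average, and two such orbits cannot stay apart.\<close>

definition linked :: bool where
  "linked \<longleftrightarrow> (\<forall>y z. bounded_below_orbit y \<and> bounded_below_orbit z \<longrightarrow>
     (\<forall>\<delta>>0. \<exists>m n. dist ((T ^^ m) y) ((T ^^ n) z) < \<delta>))"

text \<open>Follow \<open>w\<close> backwards along a calibrated orbit of \<open>x\<close>: there \<open>w' - w\<close> decreases, so it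
  equals its limit on every accumulation point and on the whole forward orbit of that
  point, along which \<open>w\<close> is still calibrated.\<close>

lemma calibrated_accumulation:
  assumes cw: "continuous_on UNIV w" and cw': "continuous_on UNIV w'"
    and sub': "\<And>y. B y + w' y \<le> w' (T y)"
    and cal: "\<And>x. \<exists>y. T y = x \<and> w x = B y + w y"
  obtains z c where "bounded_below_orbit z" "\<And>i. w' ((T ^^ i) z) - w ((T ^^ i) z) = c"
    "c \<le> w' x - w x"
proof -
  define h where "h y = w' y - w y" for y
  have ch: "continuous_on UNIV h" unfolding h_def by (intro continuous_intros cw cw')
  obtain H where H: "\<And>y. \<bar>h y\<bar> \<le> H" using bounded_continuous[OF ch] by blast
  obtain W where W: "\<And>y. \<bar>w y\<bar> \<le> W" using bounded_continuous[OF cw] by blast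
  obtain p where p: "\<And>y. T (p y) = y" "\<And>y. w y = B (p y) + w (p y)" using cal by metis
  define X where "X n = (p ^^ n) x" for n
  have TX: "T (X (Suc n)) = X n" and wX: "w (X n) = B (X (Suc n)) + w (X (Suc n))" for n
    using p(1)[of "X n"] p(2)[of "X n"] by (simp_all add: X_def)
  have TiX: "(T ^^ i) (X (n + i)) = X n" for i n
  proof (induction i)
    case (Suc i)
    then show ?case by (simp only: funpow_Suc_right comp_apply TX add_Suc_right)
  qed simp
  have SX: "w (X n) = S B i (X (n + i)) + w (X (n + i))" for i n
  proof (induction i)
    case (Suc i)
    have "S B (Suc i) (X (n + Suc i)) = B (X (Suc (n + i))) + S B i (X (n + i))"
      using birkhoff_add_time[of T B 1 i "X (Suc (n + i))"] by (simp add: birkhoff_Suc TX)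
    then show ?case using Suc wX[of "n + i"] by simp
  qed simp
  have "decseq (\<lambda>n. h (X n))"
  proof (rule decseq_SucI)
    fix n show "h (X (Suc n)) \<le> h (X n)"
      using sub'[of "X (Suc n)"] wX[of n] by (simp add: h_def TX)
  qed
  then obtain c where c: "(\<lambda>n. h (X n)) \<longlonglongrightarrow> c" "\<And>n. c \<le> h (X n)"
    using decseq_convergent[of "\<lambda>n. h (X n)" "- H"] H by (metis abs_le_D2 minus_le_iff)
  obtain z r where r: "strict_mono r" "(X \<circ> r) \<longlonglongrightarrow> z"
    using compact_space[unfolded compact_def] by (metis UNIV_I)
  have Xz: "(\<lambda>j. X (r (j + i))) \<longlonglongrightarrow> z" for i
    using LIMSEQ_ignore_initial_segment[OF r(2)] by (simp add: comp_def)
  \<comment> \<open>Index \<open>r (j + i)\<close> is at least \<open>i\<close>, so \<open>i\<close> forward steps from there stay on the backward orbit.\<close>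
  have lim: "(\<lambda>j. f (X (r (j + i) - i))) \<longlonglongrightarrow> f ((T ^^ i) z)" if f: "continuous_on UNIV f"
    for f :: "'a \<Rightarrow> real" and i
  proof -
    have "continuous_on UNIV (\<lambda>y. f ((T ^^ i) y))"
      using continuous_on_compose2[OF f continuous_iterate] by simp
    from continuous_on_tendsto_compose[OF this Xz]
    have "(\<lambda>j. f ((T ^^ i) (X (r (j + i))))) \<longlonglongrightarrow> f ((T ^^ i) z)" by simp
    moreover have "(T ^^ i) (X (r (j + i))) = X (r (j + i) - i)" for j
      using TiX[of i "r (j + i) - i"] seq_suble[OF r(1), of "j + i"] by simp
    ultimately show ?thesis by simp
  qed
  have hz: "h ((T ^^ i) z) = c" for i
  proof (rule LIMSEQ_unique[OF lim[OF ch]])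
    have "filterlim (\<lambda>j. r (j + i) - i) at_top sequentially"
      unfolding filterlim_at_top eventually_sequentially
    proof (intro allI exI impI)
      fix N j :: nat assume "N \<le> j"
      then show "N \<le> r (j + i) - i" using seq_suble[OF r(1), of "j + i"] by simp
    qed
    then show "(\<lambda>j. h (X (r (j + i) - i))) \<longlonglongrightarrow> c" by (rule filterlim_compose[OF c(1)])
  qed
  have "w ((T ^^ i) z) = S B i z + w z" for i
  proof (rule LIMSEQ_unique[OF lim[OF cw]])
    have "continuous_on UNIV (\<lambda>y. S B i y + w y)"
      by (intro continuous_intros continuous_birkhoff cont_B cw)
    from continuous_on_tendsto_compose[OF this Xz]
    have "(\<lambda>j. S B i (X (r (j + i))) + w (X (r (j + i)))) \<longlonglongrightarrow> S B i z + w z" by simp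
    moreover have "w (X (r (j + i) - i)) = S B i (X (r (j + i))) + w (X (r (j + i)))" for j
      using SX[of "r (j + i) - i" i] seq_suble[OF r(1), of "j + i"] by simp
    ultimately show "(\<lambda>j. w (X (r (j + i) - i))) \<longlonglongrightarrow> S B i z + w z" by simp
  qed
  then have "- (2 * W) \<le> S B i z" for i using W[of z] W[of "(T ^^ i) z"] by (smt (verit))
  then have "bounded_below_orbit z" unfolding bounded_below_orbit_def by blast
  moreover have "c \<le> w' x - w x" using c(2)[of 0] by (simp add: h_def X_def)
  ultimately show ?thesis using hz by (intro that) (auto simp: h_def)
qed

lemma eigenfunction_unique:
  assumes linked and u: "tropical_eigenfunction T A u" and u': "tropical_eigenfunction T A u'"
  shows "\<exists>c::real. u' = (\<lambda>x. u x \<otimes>\<^sub>t ereal c)"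
proof -
  obtain \<kappa> \<kappa>' where eig: "eigenfunction_for T A \<kappa> u" "eigenfunction_for T A \<kappa>' u'"
    using u u' unfolding tropical_eigenfunction_def by blast
  obtain w where w: "u = (\<lambda>x. ereal (w x))" "continuous_on UNIV w"
    "\<And>y. B y + w y \<le> w (T y)" "\<And>x. \<exists>y. T y = x \<and> w x = B y + w y"
    by (rule eigenfunction_structure[OF eig(1)]) blast
  obtain w' where w': "u' = (\<lambda>x. ereal (w' x))" "continuous_on UNIV w'"
    "\<And>y. B y + w' y \<le> w' (T y)" "\<And>x. \<exists>y. T y = x \<and> w' x = B y + w' y"
    by (rule eigenfunction_structure[OF eig(2)]) blast
  define h where "h y = w' y - w y" for y
  have ch: "continuous_on UNIV h" unfolding h_def by (intro continuous_intros w w')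
  then have uc: "uniformly_continuous_on UNIV h" using compact_space by (rule compact_uniformly_continuous)
  have "h x' \<le> h x" for x x'
  proof -
    obtain z c where z: "bounded_below_orbit z" "\<And>i. h ((T ^^ i) z) = c" "c \<le> h x"
      unfolding h_def using calibrated_accumulation[OF w(2) w'(2,3) w(4), of x] by blast
    obtain z' c' where z': "bounded_below_orbit z'" "\<And>i. w ((T ^^ i) z') - w' ((T ^^ i) z') = c'"
        "c' \<le> w x' - w' x'"
      using calibrated_accumulation[OF w'(2) w(2,3) w'(4), of x'] by blast
    have hz': "h ((T ^^ i) z') = - c'" for i using z'(2)[of i] by (simp add: h_def)
    have "\<bar>c - (- c')\<bar> \<le> e" if "0 < e" for e
    proof -
      obtain \<delta> where \<delta>: "\<delta> > 0" "\<And>y y'. dist y' y < \<delta> \<Longrightarrow> dist (h y') (h y) < e"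
        by (rule uniformly_continuous_onE[OF uc \<open>0 < e\<close>]) blast
      obtain m n where mn: "dist ((T ^^ m) z) ((T ^^ n) z') < \<delta>"
        using \<open>linked\<close> z(1) z'(1) \<delta>(1) unfolding linked_def by blast
      then show ?thesis using \<delta>(2)[OF mn] by (simp add: z(2) hz' dist_real_def)
    qed
    then have "\<bar>c - (- c')\<bar> \<le> 0" by (rule field_le_epsilon) simp
    then show ?thesis using z(3) z'(3) by (simp add: h_def)
  qed
  then have "h x = h undefined" for x by (simp add: antisym)
  then have "w' x = w x + h undefined" for x by (simp add: h_def algebra_simps)
  then show ?thesis by (intro exI[of _ "h undefined"]) (simp add: w(1) w'(1))
qed

section \<open>Eigen-densities\<close>

text \<open>The open sublevel sets \<open>{b < n}\<close> cover the compact space.\<close>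

lemma density_bounded:
  fixes b :: "'a \<Rightarrow> ereal"
  assumes b: "b \<in> D_max - {\<lambda>_. \<infinity>, \<lambda>_. -\<infinity>}"
  obtains K where "\<And>x. b x \<le> ereal K"
proof -
  have "usc b" and fin: "b x < \<infinity>" for x
  proof -
    show "usc b" using b by (auto simp: D_max_def)
    have "b x \<in> range ereal \<union> {-\<infinity>}" using b by (auto simp: D_max_def)
    then show "b x < \<infinity>" by auto
  qed
  then have op: "\<And>n::nat. open {x. b x < ereal (real n)}" by (simp add: usc_def)
  have cov: "UNIV \<subseteq> (\<Union>n\<in>(UNIV::nat set). {x. b x < ereal (real n)})"
  proof
    fix x
    obtain r where "b x < ereal r" using fin[of x] ereal_dense2 by blast
    moreover obtain n :: nat where "r \<le> real n" using real_arch_simple by blast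
    ultimately have "b x < ereal (real n)" by (metis ereal_less_eq(3) order_less_le_trans)
    then show "x \<in> (\<Union>n\<in>(UNIV::nat set). {x. b x < ereal (real n)})" by blast
  qed
  obtain F where F: "F \<subseteq> UNIV" "finite F" "UNIV \<subseteq> (\<Union>n\<in>F. {x. b x < ereal (real n)})"
    by (rule compactE_image[OF compact_space op cov])
  have "b x \<le> ereal (real (Max F))" for x
  proof -
    have "x \<in> (\<Union>n\<in>F. {x. b x < ereal (real n)})" using F(3) by blast
    then obtain n where n: "n \<in> F" "b x < ereal (real n)" by blast
    have "real n \<le> real (Max F)" using F(2) n(1) by simp
    then show ?thesis using n(2) by (metis ereal_less_eq(3) less_imp_le order_trans)
  qed
  then show ?thesis by (rule that)
qed

lemma density_iterate:
  assumes "adjoint_op T A b = (\<lambda>x. b x \<otimes>\<^sub>t ereal k)"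
  shows "b ((T ^^ n) x) + ereal (S A n x) = b x + ereal (real n * k)"
proof (induction n)
  case (Suc n)
  have step: "b (T y) + ereal (A y) = b y + ereal k" for y
    using fun_cong[OF assms, of y] by (simp add: adjoint_op_def)
  have "b ((T ^^ Suc n) x) + ereal (S A (Suc n) x)
      = (b (T ((T ^^ n) x)) + ereal (A ((T ^^ n) x))) + ereal (S A n x)"
    by (simp add: birkhoff_Suc add.assoc flip: plus_ereal.simps(1)) (simp add: add.commute)
  also have "\<dots> = (b ((T ^^ n) x) + ereal (S A n x)) + ereal k"
    unfolding step by (simp add: ac_simps)
  also have "\<dots> = b x + ereal (real (Suc n) * k)"
    unfolding Suc by (cases "b x") (simp_all add: algebra_simps)
  finally show ?case .
qed simp

lemma density_iterate_B:
  assumes "adjoint_op T A b = (\<lambda>x. b x \<otimes>\<^sub>t ereal (Q T A))"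
  shows "b x = b ((T ^^ n) x) + ereal (S B n x)"
  using density_iterate[OF assms, of n x]
  by (cases "b x"; cases "b ((T ^^ n) x)") (auto simp: S_B)

lemma adjoint_eigenvalue_real:
  assumes "eigendensity_for T A \<kappa> b" and "\<kappa> \<noteq> -\<infinity>"
  obtains k where "\<kappa> = ereal k"
proof (cases \<kappa>)
  case PInf
  have b: "b \<in> D_max - {\<lambda>_. \<infinity>, \<lambda>_. -\<infinity>}" and eq: "adjoint_op T A b = (\<lambda>x. b x \<otimes>\<^sub>t \<infinity>)"
    using assms PInf by (auto simp: eigendensity_for_def)
  obtain K where K: "\<And>x. b x \<le> ereal K" using density_bounded[OF b] by blast
  have "b x = -\<infinity>" for x
    using fun_cong[OF eq, of x] K[of "T x"]
    by (cases "b (T x)"; cases "b x") (auto simp: adjoint_op_def tmult_def)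
  then have "b = (\<lambda>_. -\<infinity>)" by auto
  then show ?thesis using b by simp
qed (use assms that in auto)

text \<open>Along a forward orbit \<open>n \<kappa> - S A n\<close> is an increment of the density, hence bounded above, while \<open>S A n\<close> is at most
  \<open>n Q\<close> up to a constant.\<close>

lemma adjoint_eigenvalue_le:
  assumes "adjoint_eigenvalue T A \<kappa>"
  shows "\<kappa> \<le> ereal (Q T A)"
proof (cases "\<kappa> = -\<infinity>")
  case False
  obtain b where eig: "eigendensity_for T A \<kappa> b" using assms by (auto simp: adjoint_eigenvalue_def)
  then obtain k where k: "\<kappa> = ereal k" using adjoint_eigenvalue_real[OF _ False] by blast
  have b: "b \<in> D_max - {\<lambda>_. \<infinity>, \<lambda>_. -\<infinity>}" and eq: "adjoint_op T A b = (\<lambda>x. b x \<otimes>\<^sub>t ereal k)"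
    using eig k by (auto simp: eigendensity_for_def)
  obtain K where K: "\<And>x. b x \<le> ereal K" using density_bounded[OF b] by blast
  obtain x where x: "b x \<noteq> -\<infinity>" using b by auto
  then obtain r where r: "b x = ereal r" using K[of x] by (cases "b x") auto
  obtain K' where K': "\<And>n x. S B n x \<le> K'" using S_B_bound by blast
  have "real n * (k - Q T A) \<le> K' + K - r" for n
    using density_iterate[OF eq, of n x] K[of "(T ^^ n) x"] K'[of n x]
    by (cases "b ((T ^^ n) x)") (auto simp: r S_B algebra_simps)
  from slope_nonpos[OF this] show ?thesis by (simp add: k)
qed simp

text \<open>If \<open>V\<close> is finite at a point carrying mass, that point has preimages of arbitrarily high order with
  bounded Birkhoff sums of \<open>B\<close>; a smaller eigenvalue would make the density blow up there.\<close>

lemma adjoint_eigenvalue_unique: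
  assumes fin: "\<And>x. V (\<lambda>_. 0) x \<noteq> -\<infinity>" and "adjoint_eigenvalue T A \<kappa>"
  shows "\<kappa> = ereal (Q T A)"
proof (rule antisym)
  show "\<kappa> \<le> ereal (Q T A)" using assms(2) by (rule adjoint_eigenvalue_le)
  obtain b where eig: "eigendensity_for T A \<kappa> b" using assms by (auto simp: adjoint_eigenvalue_def)
  have b: "b \<in> D_max - {\<lambda>_. \<infinity>, \<lambda>_. -\<infinity>}" and eq: "adjoint_op T A b = (\<lambda>x. b x \<otimes>\<^sub>t \<kappa>)"
    using eig by (auto simp: eigendensity_for_def)
  obtain K where K: "\<And>x. b x \<le> ereal K" using density_bounded[OF b] by blast
  obtain y where y: "b y \<noteq> -\<infinity>" using b by auto
  then obtain r where r: "b y = ereal r" using K[of y] by (cases "b y") auto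
  obtain c where c: "ereal c < V (\<lambda>_. 0) y"
    using fin[of y] ereal_dense2[of "-\<infinity>" "V (\<lambda>_. 0) y"] by auto
  have many: "\<exists>n\<ge>N. \<exists>x. (T ^^ n) x = y \<and> c \<le> S B n x" for N
  proof (rule ccontr)
    assume none: "\<not> ?thesis"
    have "V_n (\<lambda>_. 0) n y \<le> ereal c" if "n \<ge> N" for n
    proof (rule V_n_le)
      fix x assume "(T ^^ n) x = y"
      then have "\<not> c \<le> S B n x" using none that by blast
      then show "ereal (0 + S B n x) \<le> ereal c" by simp
    qed
    then have "V (\<lambda>_. 0) y \<le> ereal c"
      unfolding limsup_iterates_eq by (intro Limsup_bounded) (auto simp: eventually_sequentially)
    then show False using c by simp
  qed
  have "\<kappa> \<noteq> -\<infinity>"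
  proof
    assume k: "\<kappa> = -\<infinity>"
    obtain n x where "n \<ge> 1" "(T ^^ n) x = y" using many[of 1] by blast
    then obtain x' where "T x' = y" by (cases n) auto
    then show False using fun_cong[OF eq, of x'] r by (auto simp: k adjoint_op_def tmult_def)
  qed
  then obtain k where k: "\<kappa> = ereal k" using adjoint_eigenvalue_real[OF eig] by blast
  have "Q T A \<le> k"
  proof (rule ccontr)
    assume "\<not> Q T A \<le> k"
    then have pos: "Q T A - k > 0" by simp
    obtain N :: nat where N: "K - r - c < real N * (Q T A - k)" using reals_Archimedean3[OF pos] by blast
    obtain n x where n: "N \<le> n" "(T ^^ n) x = y" "c \<le> S B n x" using many by blast
    have "real N * (Q T A - k) \<le> real n * (Q T A - k)" using n(1) pos by (intro mult_right_mono) auto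
    moreover have "r + S A n x \<le> K + real n * k"
      using density_iterate[OF eq[unfolded k], of n x] K[of x] n(2) by (cases "b x") (auto simp: r)
    ultimately show False using N n(3) by (simp add: S_B algebra_simps)
  qed
  then show "ereal (Q T A) \<le> \<kappa>" by (simp add: k)
qed

definition subaction :: "'a \<Rightarrow> real" where
  "subaction = (SOME v. v \<in> holder_space \<alpha> \<and> (\<forall>x. B x + v x \<le> v (T x)))"

lemma subaction: "subaction \<in> holder_space \<alpha>" "B x + subaction x \<le> subaction (T x)"
proof -
  have "\<exists>v. v \<in> holder_space \<alpha> \<and> (\<forall>x. B x + v x \<le> v (T x))" using subaction_exists by metis
  from someI_ex[OF this] show "subaction \<in> holder_space \<alpha>" "B x + subaction x \<le> subaction (T x)"
    unfolding subaction_def by blast+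
qed

lemma cont_subaction: "continuous_on UNIV subaction"
  using subaction(1) \<alpha>_pos by (rule holder_continuous)

lemma subaction_le: "S B n x + subaction x \<le> subaction ((T ^^ n) x)"
  by (rule birkhoff_subaction_le) (rule subaction(2))

text \<open>Up to adding the sub-action, this is the infinite Birkhoff sum of the nonpositive \<open>B + v - v \<circ> T\<close>.  As an infimum of
  continuous functions it is upper semi-continuous, and as the terms decrease in \<open>n\<close> the first one may be
  dropped, which is the eigen-equation.\<close>

definition contact_density :: "'a \<Rightarrow> ereal" where
  "contact_density x = (INF n. ereal (S B n x - subaction ((T ^^ n) x)))"

lemma contact_density_le: "contact_density x \<le> ereal (S B n x - subaction ((T ^^ n) x))"
  unfolding contact_density_def by (rule INF_lower) simp

lemma contact_density_less_infinity: "contact_density x < \<infinity>"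
  using contact_density_le[of x 0] by (rule order_le_less_trans) simp

lemma usc_contact_density: "usc contact_density"
proof -
  let ?g = "\<lambda>n x. S B n x - subaction ((T ^^ n) x)"
  have c: "continuous_on UNIV (?g n)" for n
    by (intro continuous_on_diff continuous_birkhoff cont_B
        continuous_on_compose2[OF cont_subaction continuous_iterate]) auto
  have "open {x. contact_density x < c}" for c
  proof -
    have "{x. contact_density x < c} = (\<Union>n. {x. ereal (?g n x) < c})"
      unfolding contact_density_def by (auto simp: INF_less_iff)
    moreover have "open {x. ereal (?g n x) < c}" for n
      by (intro open_Collect_less continuous_on_ereal[OF c] continuous_on_const)
    ultimately show ?thesis by auto
  qed
  then show ?thesis by (simp add: usc_def)
qed

lemma contact_density_step: "contact_density (T x) + ereal (A x) = contact_density x + ereal (Q T A)"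
proof -
  let ?g = "\<lambda>n x. S B n x - subaction ((T ^^ n) x)"
  have shift: "?g n (T x) = ?g (Suc n) x - B x" for n
    using birkhoff_add_time[of T B 1 n x] by (simp add: birkhoff_Suc funpow_swap1)
  have dec: "?g (Suc n) x \<le> ?g n x" for n
    using subaction(2)[of "(T ^^ n) x"] by (simp add: birkhoff_Suc)
  have "contact_density (T x) + ereal (B x) = contact_density x"
  proof (rule antisym)
    show "contact_density (T x) + ereal (B x) \<le> contact_density x"
      unfolding contact_density_def[of x]
    proof (rule INF_greatest)
      fix n
      have "contact_density (T x) + ereal (B x) \<le> ereal (?g n (T x)) + ereal (B x)"
        by (intro add_right_mono contact_density_le)
      also have "\<dots> \<le> ereal (?g n x)" using dec[of n] unfolding shift by simp
      finally show "contact_density (T x) + ereal (B x) \<le> ereal (?g n x)" .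
    qed
    have "contact_density x - ereal (B x) \<le> contact_density (T x)"
      unfolding contact_density_def[of "T x"]
    proof (rule INF_greatest)
      fix n
      have "contact_density x - ereal (B x) \<le> ereal (?g (Suc n) x) - ereal (B x)"
        by (intro ereal_minus_mono contact_density_le) simp
      then show "contact_density x - ereal (B x) \<le> ereal (?g n (T x))" unfolding shift by simp
    qed
    then show "contact_density x \<le> contact_density (T x) + ereal (B x)" by (simp add: ereal_minus_le)
  qed
  then show ?thesis
    by (cases "contact_density x"; cases "contact_density (T x)") (auto simp: B_def)
qed

lemma contact_density_eigendensity: "eigendensity_for T A (ereal (Q T A)) contact_density"
proof -
  obtain z where z: "\<And>n. S B n z = subaction ((T ^^ n) z) - subaction z"
    using contact_orbit[OF subaction(1)] subaction(2) by blast
  have "contact_density z = ereal (- subaction z)" unfolding contact_density_def z by simp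
  then have ne: "contact_density \<noteq> (\<lambda>_. -\<infinity>)" "contact_density \<noteq> (\<lambda>_. \<infinity>)" by (auto dest: fun_cong[of _ _ z])
  have "contact_density x \<in> range ereal \<union> {-\<infinity>}" for x
    using contact_density_less_infinity[of x] by (cases "contact_density x") auto
  then have "contact_density \<in> D_max" using usc_contact_density by (auto simp: D_max_def)
  then show ?thesis
    using ne contact_density_step by (simp add: eigendensity_for_def adjoint_op_def)
qed

lemma contact_density_support:
  assumes "contact_density y \<noteq> -\<infinity>" shows "bounded_below_orbit y"
proof -
  obtain s where s: "contact_density y = ereal s"
    using assms contact_density_less_infinity[of y] by (cases "contact_density y") auto
  obtain b where b: "\<And>x. \<bar>subaction x\<bar> \<le> b" using bounded_continuous[OF cont_subaction] by blast
  have "- (b - s) \<le> S B n y" for n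
    using contact_density_le[of y n] b[of "(T ^^ n) y"] by (simp add: s abs_le_iff)
  then show ?thesis unfolding bounded_below_orbit_def by blast
qed

lemma density_support:
  assumes eig: "eigendensity_for T A (ereal (Q T A)) b" and y: "b y \<noteq> -\<infinity>"
  shows "bounded_below_orbit y"
proof -
  have b: "b \<in> D_max - {\<lambda>_. \<infinity>, \<lambda>_. -\<infinity>}"
    and eq: "adjoint_op T A b = (\<lambda>x. b x \<otimes>\<^sub>t ereal (Q T A))"
    using eig by (auto simp: eigendensity_for_def)
  obtain K where K: "\<And>x. b x \<le> ereal K" using density_bounded[OF b] by blast
  obtain r where r: "b y = ereal r" using y K[of y] by (cases "b y") auto
  have "- (K - r) \<le> S B n y" for n
    using density_iterate_B[OF eq, of y n] K[of "(T ^^ n) y"] r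
    by (cases "b ((T ^^ n) y)") auto
  then show ?thesis unfolding bounded_below_orbit_def by blast
qed

text \<open>When the orbits of \<open>y\<close> and \<open>z\<close> nearly meet, pull the orbit of \<open>y\<close> back along the past of
  the orbit of \<open>z\<close>.  This gives points close to \<open>z\<close> on which the eigen-equation bounds \<open>b\<close> from
  below; upper semi-continuity passes the bound to \<open>z\<close>.\<close>

lemma density_transport:
  assumes linked and eig: "eigendensity_for T A (ereal (Q T A)) b"
  shows "b y + ereal (subaction y) + contact_density z \<le> b z"
proof (cases "b y = -\<infinity> \<or> contact_density z = -\<infinity>")
  case True
  have "b \<in> D_max - {\<lambda>_. \<infinity>, \<lambda>_. -\<infinity>}" using eig by (simp add: eigendensity_for_def)
  then obtain K where K: "\<And>x. b x \<le> ereal K" by (rule density_bounded) blast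
  have b_fin: "b y \<noteq> \<infinity>" using K[of y] by auto
  show ?thesis
    using True contact_density_less_infinity[of z] b_fin
    by (cases "b y"; cases "contact_density z") auto
next
  case False
  have b: "b \<in> D_max - {\<lambda>_. \<infinity>, \<lambda>_. -\<infinity>}"
    and eq: "adjoint_op T A b = (\<lambda>x. b x \<otimes>\<^sub>t ereal (Q T A))"
    using eig by (auto simp: eigendensity_for_def)
  obtain K where K: "\<And>x. b x \<le> ereal K" using density_bounded[OF b] by blast
  obtain \<beta> where \<beta>: "b y = ereal \<beta>" using False K[of y] by (cases "b y") auto
  obtain s where s: "contact_density z = ereal s"
    using False contact_density_less_infinity[of z] by (cases "contact_density z") auto
  have supp: "bounded_below_orbit y" "bounded_below_orbit z"
    using density_support[OF eig] contact_density_support False by auto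
  let ?r = "\<beta> + subaction y + s"
  show ?thesis
  proof (rule ccontr)
    assume "\<not> ?thesis"
    then have "b z < ereal ?r" by (simp add: \<beta> s)
    then obtain r where r: "b z < ereal r" "r < ?r" using ereal_dense2 by (metis less_ereal.simps(1))
    have "open {x. b x < ereal r}" using b by (auto simp: D_max_def usc_def)
    then obtain \<rho> where \<rho>: "\<rho> > 0" "\<And>x. dist x z < \<rho> \<Longrightarrow> b x < ereal r"
      using r(1) unfolding open_dist by auto
    obtain C where C: "0 \<le> C" "\<And>n x x' y. dist x x' < \<xi> \<Longrightarrow> (T ^^ n) y = x \<Longrightarrow>
       \<exists>y'. (T ^^ n) y' = x' \<and> dist y y' \<le> dist x x' \<and>
         \<bar>(0 + S B n y) - (0 + S B n y')\<bar> \<le> C * dist x x' powr \<alpha>"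
      using preimage_transfer[OF holder_space_const[of 0]] by blast
    obtain C' where C': "0 \<le> C'" "\<And>x y. \<bar>subaction x - subaction y\<bar> \<le> C' * dist x y powr \<alpha>"
      using holder_spaceE[OF subaction(1)] by blast
    have "((\<lambda>d. (C + C') * d powr \<alpha>) \<longlongrightarrow> (C + C') * 0 powr \<alpha>) (at_right 0)"
      using \<alpha>_pos by (intro tendsto_intros) (auto intro: eventually_mono[OF eventually_at_right_less[of 0]])
    then have "\<forall>\<^sub>F d in at_right 0. (C + C') * d powr \<alpha> < ?r - r"
      using r(2) \<alpha>_pos by (intro order_tendstoD(2)) auto
    moreover have "\<forall>\<^sub>F d in at_right 0. d < min \<rho> \<xi>"
      using \<rho>(1) \<xi>_pos by (intro eventually_at_rightI[of 0 "min \<rho> \<xi>"]) auto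
    moreover have "\<forall>\<^sub>F d in at_right (0::real). 0 < d" by (rule eventually_at_right_less)
    ultimately have "\<forall>\<^sub>F d in at_right 0. (C + C') * d powr \<alpha> < ?r - r \<and> d < min \<rho> \<xi> \<and> 0 < d"
      by (intro eventually_conj)
    from eventually_happens'[OF trivial_limit_at_right_real this]
    obtain d where d: "(C + C') * d powr \<alpha> < ?r - r" "d < min \<rho> \<xi>" "0 < d" by blast
    obtain m n where mn: "dist ((T ^^ m) y) ((T ^^ n) z) < d"
      using \<open>linked\<close> supp d(3) unfolding linked_def by blast
    let ?a = "(T ^^ n) z" and ?b = "(T ^^ m) y"
    have near: "dist ?a ?b < \<xi>" using mn d(2) by (simp add: dist_commute)
    obtain x where x: "(T ^^ n) x = ?b" "dist z x \<le> dist ?a ?b"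
        "\<bar>S B n z - S B n x\<bar> \<le> C * dist ?a ?b powr \<alpha>"
      using C(2)[OF near refl] by auto
    have "dist ?a ?b powr \<alpha> \<le> d powr \<alpha>"
      using mn \<alpha>_pos by (intro powr_mono2) (auto simp: dist_commute)
    then have "(C + C') * dist ?a ?b powr \<alpha> \<le> (C + C') * d powr \<alpha>"
      using C(1) C'(1) by (intro mult_left_mono) auto
    then have small: "C * dist ?a ?b powr \<alpha> + C' * dist ?a ?b powr \<alpha> < ?r - r"
      using d(1) by (simp add: distrib_right)
    have bx: "b x = b ?b + ereal (S B n x)" using density_iterate_B[OF eq, of x n] x(1) by simp
    have ry: "ereal \<beta> = b ?b + ereal (S B m y)" using density_iterate_B[OF eq, of y m] \<beta> by simp
    then obtain \<gamma> where \<gamma>: "b ?b = ereal \<gamma>" by (cases "b ?b") auto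
    have "s \<le> S B n z - subaction ?a" using contact_density_le[of z n] by (simp add: s)
    moreover have "\<beta> = \<gamma> + S B m y" using ry \<gamma> by simp
    moreover have "S B m y + subaction y \<le> subaction ?b" by (rule subaction_le)
    moreover have "subaction ?b - subaction ?a \<le> C' * dist ?a ?b powr \<alpha>"
      using C'(2)[of ?a ?b] by linarith
    ultimately have "r \<le> \<gamma> + S B n x" using small x(3) by linarith
    then have "ereal r \<le> b x" unfolding bx \<gamma> by simp
    moreover have "dist x z < \<rho>" using x(2) mn d(2) by (simp add: dist_commute)
    ultimately show False using \<rho>(2)[of x] by simp
  qed
qed

text \<open>Let \<open>c\<close> be the supremum of \<open>b + v\<close>, with \<open>v\<close> the sub-action.  The eigen-equation expresses \<open>b\<close> at \<open>x\<close> by its value at \<open>T^n x\<close>, which is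
  at most \<open>c\<close> minus the sub-action there, so \<open>b\<close> is at most \<open>contact_density + c\<close>; transport from points where
  \<open>b + v\<close> is near its supremum gives the reverse.\<close>

lemma density_unique:
  assumes linked and eig: "eigendensity_for T A (ereal (Q T A)) b"
  shows "\<exists>c::real. b = (\<lambda>x. contact_density x \<otimes>\<^sub>t ereal c)"
proof -
  have b: "b \<in> D_max - {\<lambda>_. \<infinity>, \<lambda>_. -\<infinity>}"
    and eq: "adjoint_op T A b = (\<lambda>x. b x \<otimes>\<^sub>t ereal (Q T A))"
    using eig by (auto simp: eigendensity_for_def)
  obtain K where K: "\<And>x. b x \<le> ereal K" using density_bounded[OF b] by blast
  obtain M where M: "\<And>x. \<bar>subaction x\<bar> \<le> M" using bounded_continuous[OF cont_subaction] by blast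
  obtain y where y: "b y \<noteq> -\<infinity>" using b by auto
  define s where "s = (SUP y. b y + ereal (subaction y))"
  have up: "b y + ereal (subaction y) \<le> s" for y unfolding s_def by (rule SUP_upper) simp
  have "b x + ereal (subaction x) \<le> ereal K + ereal M" for x
    using K[of x] M[of x] by (intro add_mono) auto
  then have "s \<le> ereal K + ereal M" unfolding s_def by (intro SUP_least)
  moreover have "s \<noteq> -\<infinity>" using up[of y] y by (cases "b y") auto
  ultimately obtain c where c: "s = ereal c" by (cases s) auto
  have "b x = contact_density x + ereal c" for x
  proof (rule antisym)
    have "b x - ereal c \<le> contact_density x"
      unfolding contact_density_def
    proof (rule INF_greatest)
      fix n
      show "b x - ereal c \<le> ereal (S B n x - subaction ((T ^^ n) x))"
        using density_iterate_B[OF eq, of x n] up[of "(T ^^ n) x"]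
        by (cases "b ((T ^^ n) x)") (auto simp: c)
    qed
    then show "b x \<le> contact_density x + ereal c" by (simp add: ereal_minus_le)
    show "contact_density x + ereal c \<le> b x"
    proof (cases "contact_density x")
      case (real r)
      have "b y + ereal (subaction y) \<le> b x - ereal r" for y
        using density_transport[OF assms, of y x] by (simp add: real ereal_le_minus)
      then have "s \<le> b x - ereal r" unfolding s_def by (intro SUP_least)
      then have "s + ereal r \<le> b x" by (simp add: ereal_le_minus)
      then show ?thesis by (simp add: real c add.commute)
    qed (use contact_density_less_infinity[of x] in auto)
  qed
  then show ?thesis by (intro exI[of _ c]) auto
qed

end

section \<open>Genericity\<close>

context open_expanding_map
begin

lemma Q_le_Q_holder_dist:
  assumes A: "A \<in> holder_space \<alpha>" "A' \<in> holder_space \<alpha>" and g: "g \<in> holder_space \<alpha>"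
  shows "Q T (\<lambda>x. A x + g x) \<le> Q T (\<lambda>x. A' x + g x) + holder_dist \<alpha> A A'"
proof (rule Q_le_Q_add)
  show "continuous_on UNIV (\<lambda>x. A x + g x)" "continuous_on UNIV (\<lambda>x. A' x + g x)"
    by (rule holder_continuous[OF holder_space_add[OF A(1) g] \<alpha>_pos],
        rule holder_continuous[OF holder_space_add[OF A(2) g] \<alpha>_pos])
  show "A x + g x \<le> A' x + g x + holder_dist \<alpha> A A'" for x
    using holder_norm_ge[OF compact_space \<alpha>_pos holder_space_diff[OF A], of x]
    by (simp add: holder_dist_def abs_le_iff)
qed

lemma holder_dist_scale:
  fixes f :: "'a \<Rightarrow> real"
  assumes "f \<in> holder_space \<alpha>"
  obtains N where "0 < N" "\<And>A s. holder_dist \<alpha> A (\<lambda>x. A x + s * f x) \<le> \<bar>s\<bar> * N"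
proof -
  obtain C where C: "0 \<le> C" "\<And>x y. \<bar>f x - f y\<bar> \<le> C * dist x y powr \<alpha>"
    using holder_spaceE[OF assms] by blast
  obtain K where K: "0 \<le> K" "\<And>x. \<bar>f x\<bar> \<le> K"
    using bounded_continuous[OF holder_continuous[OF assms \<alpha>_pos]] by blast
  show ?thesis
  proof (rule that)
    show "0 < K + C + 1" using C(1) K(1) by simp
    fix A s
    let ?g = "\<lambda>x. - s * f x"
    have eq: "(\<lambda>x. A x - (A x + s * f x)) = ?g" by auto
    have 1: "(SUP x. \<bar>?g x\<bar>) \<le> \<bar>s\<bar> * K"
      by (rule cSUP_least) (use K in \<open>auto simp: abs_mult intro: mult_left_mono\<close>)
    have 2: "(SUP (x, y). \<bar>?g x - ?g y\<bar> / dist x y powr \<alpha>) \<le> \<bar>s\<bar> * C"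
    proof (rule cSUP_least)
      fix z :: "'a \<times> 'a"
      obtain x y where z: "z = (x, y)" by force
      have "?g x - ?g y = - s * (f x - f y)" by (simp add: algebra_simps)
      then have "\<bar>?g x - ?g y\<bar> = \<bar>s\<bar> * \<bar>f x - f y\<bar>" by (simp only: abs_mult abs_minus_cancel)
      also have "\<dots> \<le> \<bar>s\<bar> * (C * dist x y powr \<alpha>)" using C(2) by (intro mult_left_mono) auto
      finally have "\<bar>?g x - ?g y\<bar> \<le> (\<bar>s\<bar> * C) * dist x y powr \<alpha>" by (simp add: mult.assoc)
      then have "\<bar>?g x - ?g y\<bar> / dist x y powr \<alpha> \<le> \<bar>s\<bar> * C"
        using C(1) by (cases "x = y") (auto simp: divide_le_eq)
      then show "(case z of (x, y) \<Rightarrow> \<bar>?g x - ?g y\<bar> / dist x y powr \<alpha>) \<le> \<bar>s\<bar> * C" by (simp add: z)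
    qed simp
    have "?g \<in> holder_space \<alpha>" by (rule holder_space_scale[OF assms])
    then have "holder_norm \<alpha> ?g \<le> \<bar>s\<bar> * K + \<bar>s\<bar> * C" using 1 2 by (simp add: holder_norm_def)
    then show "holder_dist \<alpha> A (\<lambda>x. A x + s * f x) \<le> \<bar>s\<bar> * (K + C + 1)"
      unfolding holder_dist_def eq by (simp add: algebra_simps)
  qed
qed

text \<open>As \<open>Q\<close> is convex, the condition says that its two one-sided derivatives in direction \<open>f\<close> differ by
  less than \<open>1 / (m + 1)\<close>.  Written with difference quotients it is visibly open.\<close>

definition small_kink :: "('a \<Rightarrow> real) \<Rightarrow> nat \<Rightarrow> ('a \<Rightarrow> real) set" where
  "small_kink f m = {A \<in> holder_space \<alpha>. \<exists>t>0.
     Q T (\<lambda>x. A x + t * f x) + Q T (\<lambda>x. A x + (- t) * f x) - 2 * Q T A < t / real (Suc m)}"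

lemma openin_small_kink:
  assumes f: "f \<in> holder_space \<alpha>"
  shows "openin (holder_topology \<alpha>) (small_kink f m)"
proof -
  interpret Metric_space "holder_space \<alpha> :: ('a \<Rightarrow> real) set" "holder_dist \<alpha>"
    by (rule Metric_space_holder[OF compact_space \<alpha>_pos])
  show ?thesis
    unfolding holder_topology_def openin_mtopology
  proof (intro conjI allI impI)
    show "small_kink f m \<subseteq> holder_space \<alpha>" by (auto simp: small_kink_def)
    fix A assume "A \<in> small_kink f m"
    then obtain t where A: "A \<in> holder_space \<alpha>" and t: "t > 0"
      and lt: "Q T (\<lambda>x. A x + t * f x) + Q T (\<lambda>x. A x + (- t) * f x) - 2 * Q T A < t / real (Suc m)"
      by (auto simp: small_kink_def)
    define r where "r = (t / real (Suc m) -
      (Q T (\<lambda>x. A x + t * f x) + Q T (\<lambda>x. A x + (- t) * f x) - 2 * Q T A)) / 4"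
    have "mball A r \<subseteq> small_kink f m"
    proof
      fix A' assume "A' \<in> mball A r"
      then have A': "A' \<in> holder_space \<alpha>" and d: "holder_dist \<alpha> A A' < r" by auto
      have sym: "holder_dist \<alpha> A' A = holder_dist \<alpha> A A'" by (rule commute)
      have "Q T (\<lambda>x. A' x + s * f x) \<le> Q T (\<lambda>x. A x + s * f x) + holder_dist \<alpha> A A'" for s
        using Q_le_Q_holder_dist[OF A' A holder_space_scale[OF f, of s]] sym by simp
      from this[of t] this[of "-t"]
      have "Q T (\<lambda>x. A' x + t * f x) + Q T (\<lambda>x. A' x + (- t) * f x)
        \<le> Q T (\<lambda>x. A x + t * f x) + Q T (\<lambda>x. A x + (- t) * f x) + 2 * holder_dist \<alpha> A A'" by linarith
      moreover have "Q T A \<le> Q T A' + holder_dist \<alpha> A A'"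
        using Q_le_Q_holder_dist[OF A A' holder_space_const[of 0]] by simp
      moreover have "4 * holder_dist \<alpha> A A' < t / real (Suc m) -
          (Q T (\<lambda>x. A x + t * f x) + Q T (\<lambda>x. A x + (- t) * f x) - 2 * Q T A)"
        using d unfolding r_def by (simp only: less_divide_eq_numeral1 mult.commute)
      ultimately have "Q T (\<lambda>x. A' x + t * f x) + Q T (\<lambda>x. A' x + (- t) * f x) - 2 * Q T A' < t / real (Suc m)"
        by argo
      then show "A' \<in> small_kink f m" using A' t by (auto simp: small_kink_def)
    qed
    moreover have "r > 0" using lt by (simp add: r_def)
    ultimately show "\<exists>r>0. mball A r \<subseteq> small_kink f m" by blast
  qed
qed

text \<open>On a short segment in direction \<open>f\<close> the increments of the Lipschitz function \<open>Q\<close> over a step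
  \<open>t\<close> stay in an interval of length proportional to \<open>t\<close>.  If no potential on the segment had a small
  kink, consecutive increments would rise by \<open>t / (m + 1)\<close>, which is impossible for
  many steps.\<close>

lemma dense_small_kink:
  assumes f: "f \<in> holder_space \<alpha>" and A: "A \<in> holder_space \<alpha>" and "0 < \<epsilon>"
  obtains A' where "A' \<in> small_kink f m" "holder_dist \<alpha> A A' < \<epsilon>"
proof -
  obtain N where N: "0 < N" "\<And>A s. holder_dist \<alpha> A (\<lambda>x. A x + s * f x) \<le> \<bar>s\<bar> * N"
    using holder_dist_scale[OF f] by blast
  obtain K where K: "0 \<le> K" "\<And>x. \<bar>f x\<bar> \<le> K"
    using bounded_continuous[OF holder_continuous[OF f \<alpha>_pos]] by blast
  define \<phi> where "\<phi> s = Q T (\<lambda>x. A x + s * f x)" for s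
  have cont: "continuous_on UNIV (\<lambda>x. A x + s * f x)" for s
    by (rule holder_continuous[OF holder_space_add[OF A holder_space_scale[OF f]] \<alpha>_pos])
  have lip: "\<phi> s \<le> \<phi> s' + \<bar>s - s'\<bar> * K" for s s'
    unfolding \<phi>_def
  proof (rule Q_le_Q_add[OF cont cont])
    fix x
    have "(s - s') * f x \<le> \<bar>s - s'\<bar> * \<bar>f x\<bar>" by (metis abs_ge_self abs_mult)
    also have "\<dots> \<le> \<bar>s - s'\<bar> * K" using K(2) by (intro mult_left_mono) auto
    finally show "A x + s * f x \<le> A x + s' * f x + \<bar>s - s'\<bar> * K" by (simp add: algebra_simps)
  qed
  obtain p :: nat where p: "2 * K * real (Suc m) < real p" using reals_Archimedean2 by blast
  \<comment> \<open>All potentials \<open>A + j t f\<close> with \<open>j \<le> p\<close> are within \<open>\<epsilon> / 2\<close> of \<open>A\<close>.\<close>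
  define t where "t = \<epsilon> / (2 * N * real (Suc p))"
  have t: "t > 0" using N(1) \<open>0 < \<epsilon>\<close> by (simp add: t_def)
  show ?thesis
  proof (cases "\<exists>j\<in>{1..p}. \<phi> (real j * t + t) + \<phi> (real j * t - t) - 2 * \<phi> (real j * t) < t / real (Suc m)")
    case True
    then obtain j where j: "1 \<le> j" "j \<le> p"
      "\<phi> (real j * t + t) + \<phi> (real j * t - t) - 2 * \<phi> (real j * t) < t / real (Suc m)" by auto
    let ?s = "real j * t"
    let ?A = "\<lambda>x. A x + ?s * f x"
    have eq: "Q T (\<lambda>x. ?A x + t * f x) = \<phi> (?s + t)"
      "Q T (\<lambda>x. ?A x + (- t) * f x) = \<phi> (?s - t)" "Q T ?A = \<phi> ?s"
      by (simp_all add: \<phi>_def algebra_simps)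
    have "?A \<in> holder_space \<alpha>" by (intro holder_space_add A holder_space_scale f)
    then have "?A \<in> small_kink f m"
      using j(3) t unfolding small_kink_def eq[symmetric] by blast
    moreover have "holder_dist \<alpha> A ?A < \<epsilon>"
    proof -
      have "?s * N \<le> real (Suc p) * t * N" using j(2) t N(1) by (intro mult_right_mono) auto
      also have "\<dots> = \<epsilon> / 2" using N(1) by (simp add: t_def del: of_nat_Suc)
      finally show ?thesis using N(2)[of A ?s] \<open>0 < \<epsilon>\<close> t by simp
    qed
    ultimately show ?thesis by (rule that)
  next
    case False
    define I where "I j = \<phi> (real (Suc j) * t) - \<phi> (real j * t)" for j
    have rise: "I j + t / real (Suc m) \<le> I (Suc j)" if "Suc j \<le> p" for j
    proof -
      have "\<not> \<phi> (real (Suc j) * t + t) + \<phi> (real (Suc j) * t - t) - 2 * \<phi> (real (Suc j) * t) < t / real (Suc m)"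
        using False that by (metis atLeastAtMost_iff One_nat_def Suc_le_mono zero_le)
      moreover have "real (Suc j) * t + t = real (Suc (Suc j)) * t" "real (Suc j) * t - t = real j * t"
        by (simp_all add: algebra_simps)
      ultimately show ?thesis unfolding I_def by simp
    qed
    have "I 0 + real j * (t / real (Suc m)) \<le> I j" if "j \<le> p" for j
      using that
    proof (induction j)
      case (Suc j)
      then show ?case using rise[of j] by (simp add: distrib_right add_divide_distrib)
    qed simp
    from this[of p] have "I 0 + real p * (t / real (Suc m)) \<le> I p" by simp
    moreover have "I p \<le> t * K" "- (t * K) \<le> I 0"
      using lip[of "real (Suc p) * t" "real p * t"] lip[of 0 t] t by (simp_all add: I_def algebra_simps)
    ultimately have "real p * (t / real (Suc m)) \<le> 2 * (t * K)" by linarith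
    then have "t * real p \<le> t * (2 * K * real (Suc m))" by (simp add: field_simps)
    then have "real p \<le> 2 * K * real (Suc m)" using t by (rule mult_left_le_imp_le)
    then show ?thesis using p by simp
  qed
qed

lemma closure_small_kink:
  assumes f: "f \<in> holder_space \<alpha>"
  shows "holder_topology \<alpha> closure_of (small_kink f m) = topspace (holder_topology \<alpha>)"
proof -
  interpret Metric_space "holder_space \<alpha> :: ('a \<Rightarrow> real) set" "holder_dist \<alpha>"
    by (rule Metric_space_holder[OF compact_space \<alpha>_pos])
  have "\<exists>A'\<in>small_kink f m. A' \<in> mball A r" if A: "A \<in> holder_space \<alpha>" "0 < r" for A r
  proof -
    obtain A' where "A' \<in> small_kink f m" "holder_dist \<alpha> A A' < r"
      using dense_small_kink[OF f A] by blast
    then show ?thesis using A(1) by (auto simp: small_kink_def)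
  qed
  then show ?thesis unfolding holder_topology_def metric_closure_of by auto
qed

definition net :: "nat \<Rightarrow> 'a set" where
  "net k = (SOME D. finite D \<and> (\<forall>x. \<exists>p\<in>D. dist p x < 1 / real (Suc k)))"

lemma net: "finite (net k)" "\<exists>p\<in>net k. dist p x < 1 / real (Suc k)"
proof -
  have "\<exists>D::'a set. finite D \<and> (\<forall>x. \<exists>p\<in>D. dist p x < 1 / real (Suc k))"
    using finite_net[of "1 / real (Suc k)"] by (metis of_nat_0_less_iff zero_less_Suc zero_less_divide_1_iff)
  from someI_ex[OF this] show "finite (net k)" "\<exists>p\<in>net k. dist p x < 1 / real (Suc k)"
    unfolding net_def by blast+
qed

lemma infdist_holder: "(\<lambda>x::'a. infdist x D) \<in> holder_space \<alpha>"
  by (rule lipschitz_holder[OF compact_space _ \<alpha>_pos \<alpha>_le]) (rule infdist_triangle_abs)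

text \<open>An orbit along which \<open>A\<close> has maximal average supports \<open>Q\<close> from below: after perturbing \<open>A\<close> by \<open>g\<close>, its Birkhoff sums
  still obey the uniform upper bound for the perturbed potential.\<close>

lemma Q_ge_along_orbit:
  assumes A: "A \<in> holder_space \<alpha>" and g: "g \<in> holder_space \<alpha>"
    and y: "\<And>n. - C \<le> S (\<lambda>x. A x - Q T A) n y" and c: "\<And>n. real n * c \<le> S g n y"
  shows "Q T A + c \<le> Q T (\<lambda>x. A x + g x)"
proof -
  obtain K where K: "\<And>n. S (\<lambda>x. (A x + g x) - Q T (\<lambda>x. A x + g x)) n y \<le> K"
    by (rule birkhoff_upper_bound[OF holder_space_add[OF A g]]) blast
  have "real n * (Q T A + c - Q T (\<lambda>x. A x + g x)) \<le> K + C" for n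
    using K[of n] y[of n] c[of n] birkhoff_add_scale[of T A 1 g n y]
    unfolding birkhoff_diff_const by (simp add: algebra_simps)
  from slope_nonpos[OF this] show ?thesis by simp
qed

text \<open>If two orbits with bounded below Birkhoff sums kept distance \<open>\<delta>\<close>, the distance to a finite set approximating
  the first one would average at most \<open>\<delta> / 3\<close> along the first and at least \<open>2 \<delta> / 3\<close> along the second.
  Moving \<open>A\<close> in this direction, \<open>Q\<close> would have a kink of size \<open>\<delta> / 3\<close>.\<close>

lemma small_kinks_linked:
  assumes A: "A \<in> holder_space \<alpha>"
    and kinks: "\<And>k D m. D \<subseteq> net k \<Longrightarrow> A \<in> small_kink (\<lambda>x. infdist x D) m"
  shows "holder_potential.linked T A"
proof -
  interpret holder_potential T l \<eta> \<xi> \<alpha> A by unfold_locales (rule A)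
  show ?thesis
    unfolding linked_def
  proof (intro allI impI, elim conjE, rule ccontr)
    fix y z and \<delta> :: real
    assume yz: "bounded_below_orbit y" "bounded_below_orbit z" and \<delta>: "0 < \<delta>"
      and "\<not> (\<exists>m n. dist ((T ^^ m) y) ((T ^^ n) z) < \<delta>)"
    then have apart: "\<delta> \<le> dist ((T ^^ m) y) ((T ^^ n) z)" for m n by (auto simp: not_less)
    obtain Cy where Cy: "\<And>n. - Cy \<le> S (\<lambda>x. A x - Q T A) n y"
      using yz(1) unfolding bounded_below_orbit_def B_def by blast
    obtain Cz where Cz: "\<And>n. - Cz \<le> S (\<lambda>x. A x - Q T A) n z"
      using yz(2) unfolding bounded_below_orbit_def B_def by blast
    obtain k where k: "1 / real (Suc k) < \<delta> / 3"
      using nat_approx_posE[of "\<delta> / 3"] \<delta> by auto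
    define D where "D = {p \<in> net k. \<exists>m. dist p ((T ^^ m) y) < 1 / real (Suc k)}"
    let ?f = "\<lambda>x. infdist x D"
    have near: "\<exists>p\<in>D. dist p ((T ^^ n) y) < 1 / real (Suc k)" for n
      using net(2)[of k "(T ^^ n) y"] unfolding D_def by blast
    then have "D \<noteq> {}" by blast
    have fy: "?f ((T ^^ n) y) \<le> \<delta> / 3" for n
    proof -
      obtain p where p: "p \<in> D" "dist p ((T ^^ n) y) < 1 / real (Suc k)" using near by blast
      have "dist ((T ^^ n) y) p \<le> \<delta> / 3" using p(2) k by (simp add: dist_commute)
      with p(1) show ?thesis by (rule infdist_le2)
    qed
    have fz: "2 * \<delta> / 3 \<le> ?f ((T ^^ n) z)" for n
      unfolding infdist_notempty[OF \<open>D \<noteq> {}\<close>]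
    proof (rule cINF_greatest[OF \<open>D \<noteq> {}\<close>])
      fix p assume "p \<in> D"
      then obtain m where "dist p ((T ^^ m) y) < 1 / real (Suc k)" by (auto simp: D_def)
      then show "2 * \<delta> / 3 \<le> dist ((T ^^ n) z) p"
        using apart[of m n] k dist_triangle3[of "(T ^^ m) y" "(T ^^ n) z" p]
        by (simp add: dist_commute)
    qed
    have "A \<in> small_kink ?f k" by (rule kinks[of D k]) (auto simp: D_def)
    then obtain t where t: "t > 0" "Q T (\<lambda>x. A x + t * ?f x) + Q T (\<lambda>x. A x + (- t) * ?f x) - 2 * Q T A
        < t / real (Suc k)" by (auto simp: small_kink_def)
    have "Q T A + t * (2 * \<delta> / 3) \<le> Q T (\<lambda>x. A x + t * ?f x)"
    proof (rule Q_ge_along_orbit[OF A holder_space_scale[OF infdist_holder] Cz])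
      fix n
      have "(\<Sum>i<n. t * (2 * \<delta> / 3)) \<le> (\<Sum>i<n. t * ?f ((T ^^ i) z))"
        using fz t(1) by (intro sum_mono mult_left_mono) auto
      then show "real n * (t * (2 * \<delta> / 3)) \<le> S (\<lambda>x. t * ?f x) n z" by (simp add: birkhoff_sum_def)
    qed
    moreover have "Q T A + (- t) * (\<delta> / 3) \<le> Q T (\<lambda>x. A x + (- t) * ?f x)"
    proof (rule Q_ge_along_orbit[OF A holder_space_scale[OF infdist_holder] Cy])
      fix n
      have "(\<Sum>i<n. (- t) * (\<delta> / 3)) \<le> (\<Sum>i<n. (- t) * ?f ((T ^^ i) y))"
        using fy t(1) by (intro sum_mono mult_left_mono_neg) auto
      then show "real n * ((- t) * (\<delta> / 3)) \<le> S (\<lambda>x. (- t) * ?f x) n y" by (simp add: birkhoff_sum_def)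
    qed
    moreover have "t * (2 * \<delta> / 3) = 2 * (t * (\<delta> / 3))" "(- t) * (\<delta> / 3) = - (t * (\<delta> / 3))"
      by simp_all
    moreover have "t / real (Suc k) = t * (1 / real (Suc k))" by simp
    ultimately have "t * (\<delta> / 3) < t * (1 / real (Suc k))" using t(2) by argo
    then have "\<delta> / 3 < 1 / real (Suc k)" using t(1) mult_less_cancel_left_pos by blast
    then show False using k by simp
  qed
qed

text \<open>Subsets of finite nets provide countably many directions, enough to approximate the distance to any set.\<close>

lemma generic_linked:
  assumes "\<And>A. A \<in> holder_space \<alpha> \<Longrightarrow> holder_potential.linked T A \<Longrightarrow> A \<in> G"
  shows "generic_in (holder_topology \<alpha>) G"
proof -
  interpret Metric_space "holder_space \<alpha> :: ('a \<Rightarrow> real) set" "holder_dist \<alpha>"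
    by (rule Metric_space_holder[OF compact_space \<alpha>_pos])
  define \<U> where "\<U> = (\<lambda>(D, m). small_kink (\<lambda>x. infdist x D) m) ` ((\<Union>k. Pow (net k)) \<times> UNIV)"
  have "countable \<U>"
    unfolding \<U>_def using net(1)
    by (intro countable_image countable_SIGMA countable_UN countableI_type countable_finite) auto
  moreover have "openin (holder_topology \<alpha>) U \<and> holder_topology \<alpha> closure_of U = topspace (holder_topology \<alpha>)"
    if "U \<in> \<U>" for U
    using that openin_small_kink[OF infdist_holder] closure_small_kink[OF infdist_holder]
    unfolding \<U>_def by auto
  moreover have "topspace (holder_topology \<alpha>) \<inter> \<Inter>\<U> \<subseteq> G"
  proof
    fix A assume A: "A \<in> topspace (holder_topology \<alpha>) \<inter> \<Inter>\<U>"
    then have "A \<in> holder_space \<alpha>" by (simp add: holder_topology_def)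
    moreover have "A \<in> small_kink (\<lambda>x. infdist x D) m" if "D \<subseteq> net k" for D k m
      using A that unfolding \<U>_def by auto
    ultimately show "A \<in> G" by (intro assms small_kinks_linked)
  qed
  ultimately show ?thesis unfolding generic_in_def by blast
qed

end

section \<open>Tropical eigenvalues, eigenfunctions and eigen-densities\<close>

theorem theorem3:
  fixes T :: "'a::metric_space \<Rightarrow> 'a" and A :: "'a \<Rightarrow> real" and \<alpha> :: real
  assumes "compact (UNIV :: 'a set)"
    and "continuous_on UNIV T" and "open_map_on_space T" and "distance_expanding T"
    and "0 < \<alpha>" and "\<alpha> \<le> 1"
    and "A \<in> holder_space \<alpha>"
  shows
    "(adjoint_eigenvalue T A (ereal (Q T A)) \<and>
        (\<forall>\<kappa>. adjoint_eigenvalue T A \<kappa> \<longrightarrow> \<kappa> \<le> ereal (Q T A))) \<and>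
     (\<forall>\<kappa>. tropical_eigenvalue T A \<kappa> \<longrightarrow> \<kappa> = ereal (Q T A)) \<and>
     (topologically_transitive T \<longrightarrow> (\<forall>\<kappa>. adjoint_eigenvalue T A \<kappa> \<longleftrightarrow> \<kappa> = ereal (Q T A))) \<and>
     (\<forall>u \<in> holder_space \<alpha>.
        limsup_iterates T A u \<in> cont_into (range ereal \<union> {-\<infinity>}) \<and>
        bousch T A (limsup_iterates T A u) = (\<lambda>x. limsup_iterates T A u x \<otimes>\<^sub>t ereal (Q T A))) \<and>
     ((\<exists>x. limsup_iterates T A (\<lambda>_. 0) x = -\<infinity>) \<longrightarrow> \<not> (\<exists>u. tropical_eigenfunction T A u)) \<and>
     (limsup_iterates T A (\<lambda>_. 0) \<in> cont_into (range ereal) \<longrightarrow>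
        (\<forall>u \<in> holder_space \<alpha>.
           (\<exists>w \<in> holder_space \<alpha>. limsup_iterates T A u = (\<lambda>x. ereal (w x))) \<and>
           tropical_eigenfunction T A (limsup_iterates T A u))) \<and>
     (topologically_transitive T \<longrightarrow> limsup_iterates T A (\<lambda>_. 0) \<in> cont_into (range ereal)) \<and>
     (generic_in (holder_topology \<alpha>)
        {B. \<forall>u v. tropical_eigenfunction T B u \<and> tropical_eigenfunction T B v \<longrightarrow>
              (\<exists>c::real. v = (\<lambda>x. u x \<otimes>\<^sub>t ereal c))}) \<and>
     (\<exists>b. eigendensity_for T A (ereal (Q T A)) b \<and> b \<noteq> (\<lambda>_. -\<infinity>) \<and> b \<noteq> (\<lambda>_. \<infinity>)) \<and>
     (generic_in (holder_topology \<alpha>)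
        {B. \<exists>b. eigendensity_for T B (ereal (Q T B)) b \<and>
              (\<forall>b'. eigendensity_for T B (ereal (Q T B)) b' \<longrightarrow>
                 (\<exists>c::real. b' = (\<lambda>x. b x \<otimes>\<^sub>t ereal c)))})"
proof -
  obtain l \<eta> \<xi> where "open_expanding_map T l \<eta> \<xi> \<alpha>"
    by (rule open_expanding_mapI[OF assms(1-6)])
  then have pot: "holder_potential T l \<eta> \<xi> \<alpha> B" if "B \<in> holder_space \<alpha>" for B
    using that by (intro holder_potential.intro holder_potential_axioms.intro)
  interpret P: holder_potential T l \<eta> \<xi> \<alpha> A by (rule pot[OF assms(7)])
  let ?V = "limsup_iterates T A"
  have density: "eigendensity_for T A (ereal (Q T A)) P.contact_density"
    by (rule P.contact_density_eigendensity)
  then have eigenvalue_Q: "adjoint_eigenvalue T A (ereal (Q T A))" by (auto simp: adjoint_eigenvalue_def)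
  have eigenvalue: "\<kappa> = ereal (Q T A)" if "tropical_eigenvalue T A \<kappa>" for \<kappa>
    using that P.eigenfunction_structure unfolding tropical_eigenvalue_def by metis
  have unique: "adjoint_eigenvalue T A \<kappa> \<longleftrightarrow> \<kappa> = ereal (Q T A)" if "topologically_transitive T" for \<kappa>
    using P.adjoint_eigenvalue_unique[OF P.V_finite_transitive[OF that]] eigenvalue_Q by blast
  have real_case: "\<exists>w\<in>holder_space \<alpha>. ?V u = (\<lambda>x. ereal (w x))"
    if u: "u \<in> holder_space \<alpha>" and fin: "\<And>x. ?V (\<lambda>_. 0) x \<noteq> -\<infinity>" for u
    using P.V_holder[OF u fin] by blast
  have finite_of_real: "?V (\<lambda>_. 0) x \<noteq> -\<infinity>" if "?V (\<lambda>_. 0) \<in> cont_into (range ereal)" for x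
  proof -
    have "?V (\<lambda>_. 0) x \<in> range ereal" using that by (auto simp: cont_into_def)
    then show ?thesis by auto
  qed
  have real_valued: "?V u \<in> cont_into (range ereal)"
    if u: "u \<in> holder_space \<alpha>" and fin: "\<And>x. ?V (\<lambda>_. 0) x \<noteq> -\<infinity>" for u
    using real_case[OF u fin] P.V_in_cont_into[OF u] by (auto simp: cont_into_def)
  have generic_functions: "generic_in (holder_topology \<alpha>)
        {B. \<forall>u v. tropical_eigenfunction T B u \<and> tropical_eigenfunction T B v \<longrightarrow>
              (\<exists>c::real. v = (\<lambda>x. u x \<otimes>\<^sub>t ereal c))}"
    using holder_potential.eigenfunction_unique[OF pot] by (intro P.generic_linked) blast
  have generic_densities: "generic_in (holder_topology \<alpha>)
        {B. \<exists>b. eigendensity_for T B (ereal (Q T B)) b \<and>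
              (\<forall>b'. eigendensity_for T B (ereal (Q T B)) b' \<longrightarrow>
                 (\<exists>c::real. b' = (\<lambda>x. b x \<otimes>\<^sub>t ereal c)))}"
    using holder_potential.contact_density_eigendensity[OF pot] holder_potential.density_unique[OF pot]
    by (intro P.generic_linked) blast
  show ?thesis
  proof (intro conjI allI impI ballI)
    show "adjoint_eigenvalue T A (ereal (Q T A))" by (rule eigenvalue_Q)
    show "\<kappa> \<le> ereal (Q T A)" if "adjoint_eigenvalue T A \<kappa>" for \<kappa>
      using that by (rule P.adjoint_eigenvalue_le)
    show "\<kappa> = ereal (Q T A)" if "tropical_eigenvalue T A \<kappa>" for \<kappa>
      using that by (rule eigenvalue)
    show "adjoint_eigenvalue T A \<kappa> \<longleftrightarrow> \<kappa> = ereal (Q T A)" if "topologically_transitive T" for \<kappa>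
      using that by (rule unique)
    show "?V u \<in> cont_into (range ereal \<union> {-\<infinity>})" if "u \<in> holder_space \<alpha>" for u
      using that by (rule P.V_in_cont_into)
    show "bousch T A (?V u) = (\<lambda>x. ?V u x \<otimes>\<^sub>t ereal (Q T A))" for u
      by (rule P.V_bousch)
    show "\<not> (\<exists>u. tropical_eigenfunction T A u)" if "\<exists>x. ?V (\<lambda>_. 0) x = -\<infinity>"
      using that P.eigenfunction_V_finite by blast
    show "\<exists>w\<in>holder_space \<alpha>. ?V u = (\<lambda>x. ereal (w x))"
      if "?V (\<lambda>_. 0) \<in> cont_into (range ereal)" "u \<in> holder_space \<alpha>" for u
      using real_case finite_of_real that by blast
    show "tropical_eigenfunction T A (?V u)"
      if "?V (\<lambda>_. 0) \<in> cont_into (range ereal)" "u \<in> holder_space \<alpha>" for u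
      using P.V_eigenfunction real_valued finite_of_real that by blast
    show "?V (\<lambda>_. 0) \<in> cont_into (range ereal)" if "topologically_transitive T"
      by (rule real_valued[OF holder_space_const P.V_finite_transitive[OF that]])
    show "\<exists>b. eigendensity_for T A (ereal (Q T A)) b \<and> b \<noteq> (\<lambda>_. -\<infinity>) \<and> b \<noteq> (\<lambda>_. \<infinity>)"
      using density by (intro exI[of _ P.contact_density]) (auto simp: eigendensity_for_def)
  qed (rule generic_functions generic_densities)+
qed

end
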